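(* Let $\mathscr{K}$ be an essentially small tt-category and let $X\subseteq\mathrm{Spc}(\mathscr{K})$ be a patch-dense subset. Then the space $\mathrm{Spc}(\mathscr{K})$ can be reconstructed as the spectral closure $\overline{X}^{\mathcal{U}}$ of the pair $(X,\mathcal{U})$ for $\mathcal{U}=\{\,X\cap\mathrm{supp}(k)^c : k\in\mathscr{K}\,\}$, that is, the inclusion $X\hookrightarrow\mathrm{Spc}(\mathscr{K})$ is a spectral closure of $X$ with respect to $\mathcal{U}$. In particular, $\mathrm{Spc}(\mathscr{K})$ can be reconstructed from the restricted support theory $(X,\mathrm{supp}_X)$, where $\mathrm{supp}_X(k)=X\cap\mathrm{supp}(k)$ for every $k\in\mathscr{K}$.
   Context: A tt-category is a triangulated category with a symmetric monoidal structure $\otimes$ that is exact in each variable. A tt-ideal is a thick triangulated subcategory (closed under direct summands) that is closed under tensoring with arbitrary objects; a proper tt-ideal $\mathscr{P}$ is prime if $k\otimes\ell\in\mathscr{P}$ implies $k\in\mathscr{P}$ or $\ell\in\mathscr{P}$. For $\mathscr{K}$ essentially small, $\mathrm{Spc}(\mathscr{K})$ is the set of prime tt-ideals, with the topology having as a basis of closed subsets the sets $\mathrm{supp}(k)=\{\mathscr{P} : k\notin\mathscr{P}\}$, $k\in\mathscr{K}$; it is a spectral space whose quasi-compact opens are exactly the complements $\mathrm{supp}(k)^c$. A spectral space is a quasi-compact sober topological space whose quasi-compact open subsets form a basis closed under finite intersections. A map between spectral spaces is spectral if preimages of quasi-compact opens are quasi-compact open. The constructible (or patch) topology on a spectral space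 is generated by the quasi-compact open subsets and their complements; a subset is patch-dense if it is dense for this topology. Let $X$ be a set with a non-empty collection $\mathcal{U}$ of subsets closed under finite intersections and finite unions (in particular containing $X$ and $\varnothing$). A map $f\colon X\to X'$ to a spectral space is called spectral (with respect to $\mathcal{U}$) if $f^{-1}(U)\in\mathcal{U}$ for every quasi-compact open $U\subseteq X'$. The spectral closure of $X$ with respect to $\mathcal{U}$ is the initial such map $f\colon X\to\overline{X}^{\mathcal{U}}$: any other map $f'\colon X\to X'$ to a spectral space that is spectral with respect to $\mathcal{U}$ factors as $f'=\bar f'\circ f$ for a unique spectral map $\bar f'\colon\overline{X}^{\mathcal{U}}\to X'$. *)

theory Defs
  imports "HOL-Analysis.Analysis" "HOL-Algebra.Group"
begin

section \<open>Categories\<close>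

text \<open>A (small) category is given by a set of objects and a set of arrows, each arrow carrying its
  domain and codomain; \<open>g \<cdot> f\<close> is only meaningful when \<open>Cod f = Dom g\<close>.\<close>

record ('o, 'm) category_data =
  Ob :: "'o set"
  Arr :: "'m set"
  Dom :: "'m \<Rightarrow> 'o"
  Cod :: "'m \<Rightarrow> 'o"
  Idt :: "'o \<Rightarrow> 'm"
  Comp :: "'m \<Rightarrow> 'm \<Rightarrow> 'm" (infixr "\<cdot>\<index>" 70)

definition Hom :: "('o, 'm, 'z) category_data_scheme \<Rightarrow> 'o \<Rightarrow> 'o \<Rightarrow> 'm set" where
  "Hom K A B = {f \<in> Arr K. Dom K f = A \<and> Cod K f = B}"

locale category =
  fixes K :: "('o, 'm, 'z) category_data_scheme" (structure)
  assumes Dom_in: "f \<in> Arr K \<Longrightarrow> Dom K f \<in> Ob K"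
    and Cod_in: "f \<in> Arr K \<Longrightarrow> Cod K f \<in> Ob K"
    and Idt_in: "A \<in> Ob K \<Longrightarrow> Idt K A \<in> Hom K A A"
    and Comp_in: "\<lbrakk>f \<in> Hom K A B; g \<in> Hom K B C\<rbrakk> \<Longrightarrow> g \<cdot> f \<in> Hom K A C"
    and Comp_Idt: "f \<in> Hom K A B \<Longrightarrow> f \<cdot> Idt K A = f"
    and Idt_Comp: "f \<in> Hom K A B \<Longrightarrow> Idt K B \<cdot> f = f"
    and Comp_assoc: "\<lbrakk>f \<in> Hom K A B; g \<in> Hom K B C; h \<in> Hom K C D\<rbrakk>
          \<Longrightarrow> (h \<cdot> g) \<cdot> f = h \<cdot> (g \<cdot> f)"

definition iso_arr :: "('o, 'm, 'z) category_data_scheme \<Rightarrow> 'm \<Rightarrow> 'o \<Rightarrow> 'o \<Rightarrow> bool" where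
  "iso_arr K f A B \<longleftrightarrow> f \<in> Hom K A B \<and>
     (\<exists>g \<in> Hom K B A. g \<cdot>\<^bsub>K\<^esub> f = Idt K A \<and> f \<cdot>\<^bsub>K\<^esub> g = Idt K B)"

definition endofunctor ::
    "('o, 'm, 'z) category_data_scheme \<Rightarrow> ('o \<Rightarrow> 'o) \<Rightarrow> ('m \<Rightarrow> 'm) \<Rightarrow> bool" where
  "endofunctor K F \<phi> \<longleftrightarrow>
     (\<forall>A \<in> Ob K. F A \<in> Ob K \<and> \<phi> (Idt K A) = Idt K (F A)) \<and>
     (\<forall>A \<in> Ob K. \<forall>B \<in> Ob K. \<forall>f \<in> Hom K A B. \<phi> f \<in> Hom K (F A) (F B)) \<and>
     (\<forall>A \<in> Ob K. \<forall>B \<in> Ob K. \<forall>C \<in> Ob K. \<forall>f \<in> Hom K A B. \<forall>g \<in> Hom K B C.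
        \<phi> (g \<cdot>\<^bsub>K\<^esub> f) = \<phi> g \<cdot>\<^bsub>K\<^esub> \<phi> f)"

definition autoequivalence ::
    "('o, 'm, 'z) category_data_scheme \<Rightarrow> ('o \<Rightarrow> 'o) \<Rightarrow> ('m \<Rightarrow> 'm) \<Rightarrow> bool" where
  "autoequivalence K F \<phi> \<longleftrightarrow> endofunctor K F \<phi> \<and>
     (\<forall>A \<in> Ob K. \<forall>B \<in> Ob K. bij_betw \<phi> (Hom K A B) (Hom K (F A) (F B))) \<and>
     (\<forall>B \<in> Ob K. \<exists>A \<in> Ob K. \<exists>f. iso_arr K f (F A) B)"


section \<open>Additive categories\<close>

record ('o, 'm) additive_data = "('o, 'm) category_data" +
  Add :: "'m \<Rightarrow> 'm \<Rightarrow> 'm" (infixl "\<oplus>\<index>" 65)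
  Zero :: "'o \<Rightarrow> 'o \<Rightarrow> 'm"

definition hom_group :: "('o, 'm, 'z) additive_data_scheme \<Rightarrow> 'o \<Rightarrow> 'o \<Rightarrow> 'm monoid" where
  "hom_group K A B = \<lparr>carrier = Hom K A B, mult = Add K, one = Zero K A B\<rparr>"

definition Neg :: "('o, 'm, 'z) additive_data_scheme \<Rightarrow> 'm \<Rightarrow> 'm" where
  "Neg K f = inv\<^bsub>hom_group K (Dom K f) (Cod K f)\<^esub> f"

definition zero_object :: "('o, 'm, 'z) category_data_scheme \<Rightarrow> 'o \<Rightarrow> bool" where
  "zero_object K Z \<longleftrightarrow> Z \<in> Ob K \<and>
     (\<forall>A \<in> Ob K. (\<exists>!f. f \<in> Hom K Z A) \<and> (\<exists>!f. f \<in> Hom K A Z))"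

definition biproduct :: "('o, 'm, 'z) additive_data_scheme \<Rightarrow> 'o \<Rightarrow> 'o \<Rightarrow> 'o \<Rightarrow> bool" where
  "biproduct K A B S \<longleftrightarrow> A \<in> Ob K \<and> B \<in> Ob K \<and> S \<in> Ob K \<and>
     (\<exists>i \<in> Hom K A S. \<exists>j \<in> Hom K B S. \<exists>p \<in> Hom K S A. \<exists>q \<in> Hom K S B.
        p \<cdot>\<^bsub>K\<^esub> i = Idt K A \<and> q \<cdot>\<^bsub>K\<^esub> j = Idt K B \<and>
        p \<cdot>\<^bsub>K\<^esub> j = Zero K B A \<and> q \<cdot>\<^bsub>K\<^esub> i = Zero K A B \<and>
        (i \<cdot>\<^bsub>K\<^esub> p) \<oplus>\<^bsub>K\<^esub> (j \<cdot>\<^bsub>K\<^esub> q) = Idt K S)"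

locale additive_category = category K
  for K :: "('o, 'm, 'z) additive_data_scheme" (structure) +
  assumes hom_comm_group: "\<lbrakk>A \<in> Ob K; B \<in> Ob K\<rbrakk> \<Longrightarrow> comm_group (hom_group K A B)"
    and Comp_Add: "\<lbrakk>f \<in> Hom K A B; f' \<in> Hom K A B; g \<in> Hom K B C\<rbrakk>
          \<Longrightarrow> g \<cdot> (f \<oplus> f') = (g \<cdot> f) \<oplus> (g \<cdot> f')"
    and Add_Comp: "\<lbrakk>f \<in> Hom K A B; g \<in> Hom K B C; g' \<in> Hom K B C\<rbrakk>
          \<Longrightarrow> (g \<oplus> g') \<cdot> f = (g \<cdot> f) \<oplus> (g' \<cdot> f)"
    and zero_object_exists: "\<exists>Z. zero_object K Z"
    and biproduct_exists: "\<lbrakk>A \<in> Ob K; B \<in> Ob K\<rbrakk> \<Longrightarrow> \<exists>S. biproduct K A B S"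

definition additive_endofunctor ::
    "('o, 'm, 'z) additive_data_scheme \<Rightarrow> ('o \<Rightarrow> 'o) \<Rightarrow> ('m \<Rightarrow> 'm) \<Rightarrow> bool" where
  "additive_endofunctor K F \<phi> \<longleftrightarrow> endofunctor K F \<phi> \<and>
     (\<forall>A \<in> Ob K. \<forall>B \<in> Ob K. \<forall>f \<in> Hom K A B. \<forall>g \<in> Hom K A B.
        \<phi> (f \<oplus>\<^bsub>K\<^esub> g) = \<phi> f \<oplus>\<^bsub>K\<^esub> \<phi> g)"


section \<open>Triangulated categories\<close>

text \<open>\<open>(f, g, h) \<in> Tri K\<close> stands for a distinguished triangle
  \<open>A \<rightarrow> B \<rightarrow> C \<rightarrow> \<Sigma> A\<close> with these three arrows.\<close>

record ('o, 'm) triangulated_data = "('o, 'm) additive_data" +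
  Sus :: "'o \<Rightarrow> 'o"
  SusA :: "'m \<Rightarrow> 'm"
  Tri :: "('m \<times> 'm \<times> 'm) set"

definition triangle_on :: "('o, 'm, 'z) triangulated_data_scheme \<Rightarrow>
    'o \<Rightarrow> 'o \<Rightarrow> 'o \<Rightarrow> 'm \<Rightarrow> 'm \<Rightarrow> 'm \<Rightarrow> bool" where
  "triangle_on K A B C f g h \<longleftrightarrow> A \<in> Ob K \<and> B \<in> Ob K \<and> C \<in> Ob K \<and>
     f \<in> Hom K A B \<and> g \<in> Hom K B C \<and> h \<in> Hom K C (Sus K A)"

definition distinguished_on :: "('o, 'm, 'z) triangulated_data_scheme \<Rightarrow>
    'o \<Rightarrow> 'o \<Rightarrow> 'o \<Rightarrow> 'm \<Rightarrow> 'm \<Rightarrow> 'm \<Rightarrow> bool" where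
  "distinguished_on K A B C f g h \<longleftrightarrow> triangle_on K A B C f g h \<and> (f, g, h) \<in> Tri K"

locale triangulated_category = additive_category K
  for K :: "('o, 'm, 'z) triangulated_data_scheme" (structure) +
  assumes Sus_autoequivalence: "autoequivalence K (Sus K) (SusA K)"
    and Sus_additive: "additive_endofunctor K (Sus K) (SusA K)"
    and Tri_triangle: "(f, g, h) \<in> Tri K \<Longrightarrow> \<exists>A B C. triangle_on K A B C f g h"
    and TR1_iso: "\<lbrakk>distinguished_on K A B C f g h; triangle_on K A' B' C' f' g' h';
          iso_arr K a A A'; iso_arr K b B B'; iso_arr K c C C';
          b \<cdot> f = f' \<cdot> a; c \<cdot> g = g' \<cdot> b; SusA K a \<cdot> h = h' \<cdot> c\<rbrakk>
          \<Longrightarrow> (f', g', h') \<in> Tri K"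
    and TR1_id: "\<lbrakk>A \<in> Ob K; zero_object K Z\<rbrakk>
          \<Longrightarrow> (Idt K A, Zero K A Z, Zero K Z (Sus K A)) \<in> Tri K"
    and TR1_cone: "\<lbrakk>A \<in> Ob K; B \<in> Ob K; f \<in> Hom K A B\<rbrakk>
          \<Longrightarrow> \<exists>C g h. distinguished_on K A B C f g h"
    and TR2: "triangle_on K A B C f g h
          \<Longrightarrow> (f, g, h) \<in> Tri K \<longleftrightarrow> (g, h, Neg K (SusA K f)) \<in> Tri K"
    and TR3: "\<lbrakk>distinguished_on K A B C f g h; distinguished_on K A' B' C' f' g' h';
          a \<in> Hom K A A'; b \<in> Hom K B B'; b \<cdot> f = f' \<cdot> a\<rbrakk>
          \<Longrightarrow> \<exists>c \<in> Hom K C C'. c \<cdot> g = g' \<cdot> b \<and> SusA K a \<cdot> h = h' \<cdot> c"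
    and TR4: "\<lbrakk>distinguished_on K A B D f f' f''; distinguished_on K B C F g g' g'';
          distinguished_on K A C E (g \<cdot> f) h' h''\<rbrakk>
          \<Longrightarrow> \<exists>u v. distinguished_on K D E F u v (SusA K f' \<cdot> g'') \<and>
                u \<cdot> f' = h' \<cdot> g \<and> h'' \<cdot> u = f'' \<and>
                v \<cdot> h' = g' \<and> g'' \<cdot> v = SusA K f \<cdot> h''"

text \<open>An exact functor is an additive one that commutes with the suspension up to a natural
  isomorphism \<open>\<theta>\<close>, through which it preserves distinguished triangles.\<close>

definition exact_endofunctor ::
    "('o, 'm, 'z) triangulated_data_scheme \<Rightarrow> ('o \<Rightarrow> 'o) \<Rightarrow> ('m \<Rightarrow> 'm) \<Rightarrow> bool" where
  "exact_endofunctor K F \<phi> \<longleftrightarrow> additive_endofunctor K F \<phi> \<and>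
     (\<exists>\<theta>. (\<forall>A \<in> Ob K. iso_arr K (\<theta> A) (F (Sus K A)) (Sus K (F A))) \<and>
        (\<forall>A \<in> Ob K. \<forall>B \<in> Ob K. \<forall>f \<in> Hom K A B.
           \<theta> B \<cdot>\<^bsub>K\<^esub> \<phi> (SusA K f) = SusA K (\<phi> f) \<cdot>\<^bsub>K\<^esub> \<theta> A) \<and>
        (\<forall>A B C f g h. distinguished_on K A B C f g h \<longrightarrow>
           (\<phi> f, \<phi> g, \<theta> A \<cdot>\<^bsub>K\<^esub> \<phi> h) \<in> Tri K))"


section \<open>Tensor-triangulated categories\<close>

record ('o, 'm) tt_data = "('o, 'm) triangulated_data" +
  Tens :: "'o \<Rightarrow> 'o \<Rightarrow> 'o" (infixl "\<odot>\<index>" 75)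
  TensA :: "'m \<Rightarrow> 'm \<Rightarrow> 'm" (infixl "\<boxdot>\<index>" 75)
  Unit :: 'o
  Assoc :: "'o \<Rightarrow> 'o \<Rightarrow> 'o \<Rightarrow> 'm"
  LUnit :: "'o \<Rightarrow> 'm"
  RUnit :: "'o \<Rightarrow> 'm"
  Braid :: "'o \<Rightarrow> 'o \<Rightarrow> 'm"

locale symmetric_monoidal_category = category K
  for K :: "('o, 'm, 'z) tt_data_scheme" (structure) +
  assumes Tens_in: "\<lbrakk>A \<in> Ob K; B \<in> Ob K\<rbrakk> \<Longrightarrow> A \<odot> B \<in> Ob K"
    and TensA_in: "\<lbrakk>f \<in> Hom K A A'; g \<in> Hom K B B'\<rbrakk> \<Longrightarrow> f \<boxdot> g \<in> Hom K (A \<odot> B) (A' \<odot> B')"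
    and TensA_Idt: "\<lbrakk>A \<in> Ob K; B \<in> Ob K\<rbrakk> \<Longrightarrow> Idt K A \<boxdot> Idt K B = Idt K (A \<odot> B)"
    and TensA_Comp: "\<lbrakk>f \<in> Hom K A A'; f' \<in> Hom K A' A''; g \<in> Hom K B B'; g' \<in> Hom K B' B''\<rbrakk>
          \<Longrightarrow> (f' \<cdot> f) \<boxdot> (g' \<cdot> g) = (f' \<boxdot> g') \<cdot> (f \<boxdot> g)"
    and Unit_in: "Unit K \<in> Ob K"
    and Assoc_iso: "\<lbrakk>A \<in> Ob K; B \<in> Ob K; C \<in> Ob K\<rbrakk>
          \<Longrightarrow> iso_arr K (Assoc K A B C) ((A \<odot> B) \<odot> C) (A \<odot> (B \<odot> C))"
    and Assoc_natural: "\<lbrakk>f \<in> Hom K A A'; g \<in> Hom K B B'; h \<in> Hom K C C'\<rbrakk>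
          \<Longrightarrow> Assoc K A' B' C' \<cdot> ((f \<boxdot> g) \<boxdot> h) = (f \<boxdot> (g \<boxdot> h)) \<cdot> Assoc K A B C"
    and LUnit_iso: "A \<in> Ob K \<Longrightarrow> iso_arr K (LUnit K A) (Unit K \<odot> A) A"
    and LUnit_natural: "f \<in> Hom K A B
          \<Longrightarrow> LUnit K B \<cdot> (Idt K (Unit K) \<boxdot> f) = f \<cdot> LUnit K A"
    and RUnit_iso: "A \<in> Ob K \<Longrightarrow> iso_arr K (RUnit K A) (A \<odot> Unit K) A"
    and RUnit_natural: "f \<in> Hom K A B
          \<Longrightarrow> RUnit K B \<cdot> (f \<boxdot> Idt K (Unit K)) = f \<cdot> RUnit K A"
    and Braid_iso: "\<lbrakk>A \<in> Ob K; B \<in> Ob K\<rbrakk> \<Longrightarrow> iso_arr K (Braid K A B) (A \<odot> B) (B \<odot> A)"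
    and Braid_natural: "\<lbrakk>f \<in> Hom K A A'; g \<in> Hom K B B'\<rbrakk>
          \<Longrightarrow> Braid K A' B' \<cdot> (f \<boxdot> g) = (g \<boxdot> f) \<cdot> Braid K A B"
    and Braid_symmetric: "\<lbrakk>A \<in> Ob K; B \<in> Ob K\<rbrakk>
          \<Longrightarrow> Braid K B A \<cdot> Braid K A B = Idt K (A \<odot> B)"
    and pentagon: "\<lbrakk>A \<in> Ob K; B \<in> Ob K; C \<in> Ob K; D \<in> Ob K\<rbrakk>
          \<Longrightarrow> Assoc K A B (C \<odot> D) \<cdot> Assoc K (A \<odot> B) C D =
              (Idt K A \<boxdot> Assoc K B C D) \<cdot> Assoc K A (B \<odot> C) D \<cdot> (Assoc K A B C \<boxdot> Idt K D)"
    and triangle: "\<lbrakk>A \<in> Ob K; B \<in> Ob K\<rbrakk>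
          \<Longrightarrow> (Idt K A \<boxdot> LUnit K B) \<cdot> Assoc K A (Unit K) B = RUnit K A \<boxdot> Idt K B"
    and hexagon: "\<lbrakk>A \<in> Ob K; B \<in> Ob K; C \<in> Ob K\<rbrakk>
          \<Longrightarrow> Assoc K B C A \<cdot> Braid K A (B \<odot> C) \<cdot> Assoc K A B C =
              (Idt K B \<boxdot> Braid K A C) \<cdot> Assoc K B A C \<cdot> (Braid K A B \<boxdot> Idt K C)"

text \<open>Essential smallness needs no separate assumption: objects and arrows form sets.\<close>

locale tt_category = triangulated_category K + symmetric_monoidal_category K
  for K :: "('o, 'm, 'z) tt_data_scheme" (structure) +
  assumes tensor_exact_right:
      "A \<in> Ob K \<Longrightarrow> exact_endofunctor K (\<lambda>B. A \<odot> B) (\<lambda>f. Idt K A \<boxdot> f)"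
    and tensor_exact_left:
      "B \<in> Ob K \<Longrightarrow> exact_endofunctor K (\<lambda>A. A \<odot> B) (\<lambda>f. f \<boxdot> Idt K B)"


section \<open>Prime tt-ideals and the spectrum\<close>

text \<open>Full subcategories are identified with their sets of objects.\<close>

definition triangulated_subcategory ::
    "('o, 'm, 'z) triangulated_data_scheme \<Rightarrow> 'o set \<Rightarrow> bool" where
  "triangulated_subcategory K J \<longleftrightarrow> J \<subseteq> Ob K \<and>
     (\<forall>Z. zero_object K Z \<longrightarrow> Z \<in> J) \<and>
     (\<forall>A B S. biproduct K A B S \<longrightarrow> A \<in> J \<longrightarrow> B \<in> J \<longrightarrow> S \<in> J) \<and>
     (\<forall>A \<in> Ob K. A \<in> J \<longleftrightarrow> Sus K A \<in> J) \<and>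
     (\<forall>A B C f g h. distinguished_on K A B C f g h \<longrightarrow>
        (A \<in> J \<longrightarrow> B \<in> J \<longrightarrow> C \<in> J) \<and>
        (B \<in> J \<longrightarrow> C \<in> J \<longrightarrow> A \<in> J) \<and>
        (A \<in> J \<longrightarrow> C \<in> J \<longrightarrow> B \<in> J))"

definition thick_subcategory ::
    "('o, 'm, 'z) triangulated_data_scheme \<Rightarrow> 'o set \<Rightarrow> bool" where
  "thick_subcategory K J \<longleftrightarrow> triangulated_subcategory K J \<and>
     (\<forall>A B S. biproduct K A B S \<longrightarrow> S \<in> J \<longrightarrow> A \<in> J \<and> B \<in> J)"

definition tt_ideal :: "('o, 'm, 'z) tt_data_scheme \<Rightarrow> 'o set \<Rightarrow> bool" where
  "tt_ideal K J \<longleftrightarrow> thick_subcategory K J \<and>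
     (\<forall>k \<in> J. \<forall>l \<in> Ob K. k \<odot>\<^bsub>K\<^esub> l \<in> J \<and> l \<odot>\<^bsub>K\<^esub> k \<in> J)"

definition prime_tt_ideal :: "('o, 'm, 'z) tt_data_scheme \<Rightarrow> 'o set \<Rightarrow> bool" where
  "prime_tt_ideal K P \<longleftrightarrow> tt_ideal K P \<and> P \<noteq> Ob K \<and>
     (\<forall>k \<in> Ob K. \<forall>l \<in> Ob K. k \<odot>\<^bsub>K\<^esub> l \<in> P \<longrightarrow> k \<in> P \<or> l \<in> P)"

definition supp :: "('o, 'm, 'z) tt_data_scheme \<Rightarrow> 'o \<Rightarrow> 'o set set" where
  "supp K k = {P. prime_tt_ideal K P \<and> k \<notin> P}"

definition Spc :: "('o, 'm, 'z) tt_data_scheme \<Rightarrow> 'o set topology" where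
  "Spc K = topology (arbitrary union_of
     (\<lambda>U. \<exists>k \<in> Ob K. U = {P. prime_tt_ideal K P} - supp K k))"

text \<open>The following two lemmas confirm that the sets above are indeed the open sets of a topology,
  so that \<^const>\<open>topology\<close> is not applied outside its domain.\<close>

lemma (in tt_category) openin_Spc:
  "openin (Spc K) = arbitrary union_of
     (\<lambda>U. \<exists>k \<in> Ob K. U = {P. prime_tt_ideal K P} - supp K k)"
proof -
  have "\<exists>s \<in> Ob K. ({P. prime_tt_ideal K P} - supp K k) \<inter> ({P. prime_tt_ideal K P} - supp K l) =
      {P. prime_tt_ideal K P} - supp K s" if kl: "k \<in> Ob K" "l \<in> Ob K" for k l
  proof -
    obtain s where s: "biproduct K k l s"
      using biproduct_exists[OF kl] by blast
    then have "s \<in> Ob K" by (simp add: biproduct_def)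
    moreover have "s \<in> P \<longleftrightarrow> k \<in> P \<and> l \<in> P" if "prime_tt_ideal K P" for P
      using that s unfolding prime_tt_ideal_def tt_ideal_def thick_subcategory_def
        triangulated_subcategory_def by meson
    ultimately show ?thesis
      by (intro bexI[of _ s]) (auto simp: supp_def)
  qed
  then show ?thesis
    unfolding Spc_def
    by (intro topology_inverse' istopology_base) fastforce
qed

lemma (in tt_category) topspace_Spc: "topspace (Spc K) = {P. prime_tt_ideal K P}"
proof
  show "topspace (Spc K) \<subseteq> {P. prime_tt_ideal K P}"
    unfolding topspace_def openin_Spc union_of_def by auto
  obtain Z where Z: "zero_object K Z" using zero_object_exists by blast
  have "Z \<in> P" if "prime_tt_ideal K P" for P
    using that Z unfolding prime_tt_ideal_def tt_ideal_def thick_subcategory_def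
      triangulated_subcategory_def by blast
  then have "{P. prime_tt_ideal K P} = {P. prime_tt_ideal K P} - supp K Z"
    by (auto simp: supp_def)
  then have "openin (Spc K) {P. prime_tt_ideal K P}"
    unfolding openin_Spc using Z
    by (intro arbitrary_union_of_inc) (auto simp: zero_object_def)
  then show "{P. prime_tt_ideal K P} \<subseteq> topspace (Spc K)"
    by (rule openin_subset)
qed

definition restricted_supp :: "('o, 'm, 'z) tt_data_scheme \<Rightarrow> 'o set set \<Rightarrow> 'o \<Rightarrow> 'o set set" where
  "restricted_supp K X k = X \<inter> supp K k"


section \<open>Spectral spaces\<close>

definition qc_open :: "'a topology \<Rightarrow> 'a set \<Rightarrow> bool" where
  "qc_open S U \<longleftrightarrow> openin S U \<and> compactin S U"

definition irreducible_closed :: "'a topology \<Rightarrow> 'a set \<Rightarrow> bool" where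
  "irreducible_closed S C \<longleftrightarrow> closedin S C \<and> C \<noteq> {} \<and>
     (\<forall>D E. closedin S D \<longrightarrow> closedin S E \<longrightarrow> C = D \<union> E \<longrightarrow> C = D \<or> C = E)"

definition sober_space :: "'a topology \<Rightarrow> bool" where
  "sober_space S \<longleftrightarrow>
     (\<forall>C. irreducible_closed S C \<longrightarrow> (\<exists>!x. x \<in> topspace S \<and> C = S closure_of {x}))"

definition spectral_space :: "'a topology \<Rightarrow> bool" where
  "spectral_space S \<longleftrightarrow> compact_space S \<and> sober_space S \<and>
     openin S = arbitrary union_of (qc_open S) \<and>
     (\<forall>U V. qc_open S U \<longrightarrow> qc_open S V \<longrightarrow> qc_open S (U \<inter> V))"

definition spectral_map :: "'a topology \<Rightarrow> 'b topology \<Rightarrow> ('a \<Rightarrow> 'b) \<Rightarrow> bool" where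
  "spectral_map S T f \<longleftrightarrow> f \<in> topspace S \<rightarrow> topspace T \<and>
     (\<forall>U. qc_open T U \<longrightarrow> qc_open S {x \<in> topspace S. f x \<in> U})"

definition patch_topology :: "'a topology \<Rightarrow> 'a topology" where
  "patch_topology S = topology_generated_by
     ({U. qc_open S U} \<union> {topspace S - U | U. qc_open S U})"

definition patch_dense :: "'a topology \<Rightarrow> 'a set \<Rightarrow> bool" where
  "patch_dense S X \<longleftrightarrow> X \<subseteq> topspace S \<and> patch_topology S closure_of X = topspace S"


section \<open>Spectral closures\<close>

definition set_lattice_on :: "'x set \<Rightarrow> 'x set set \<Rightarrow> bool" where
  "set_lattice_on X \<U> \<longleftrightarrow> \<U> \<subseteq> Pow X \<and> X \<in> \<U> \<and> {} \<in> \<U> \<and>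
     (\<forall>U \<in> \<U>. \<forall>V \<in> \<U>. U \<inter> V \<in> \<U> \<and> U \<union> V \<in> \<U>)"

definition spectral_wrt :: "'x set \<Rightarrow> 'x set set \<Rightarrow> 'y topology \<Rightarrow> ('x \<Rightarrow> 'y) \<Rightarrow> bool" where
  "spectral_wrt X \<U> Y f \<longleftrightarrow> f \<in> X \<rightarrow> topspace Y \<and>
     (\<forall>U. qc_open Y U \<longrightarrow> {x \<in> X. f x \<in> U} \<in> \<U>)"

text \<open>A definition cannot quantify over all types, so the type \<open>'y\<close> of the points of the test
  spaces is a parameter; the full universal property is the statement for a type variable \<open>'y\<close>.
  Functions are made unique off the carrier by extensionality.\<close>

definition spectral_closure ::
    "'y itself \<Rightarrow> 'x set \<Rightarrow> 'x set set \<Rightarrow> 'z topology \<Rightarrow> ('x \<Rightarrow> 'z) \<Rightarrow> bool" where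
  "spectral_closure (_ :: 'y itself) X \<U> Z f \<longleftrightarrow>
     set_lattice_on X \<U> \<and> spectral_space Z \<and> spectral_wrt X \<U> Z f \<and>
     (\<forall>(Y :: 'y topology) f'. spectral_space Y \<longrightarrow> spectral_wrt X \<U> Y f' \<longrightarrow>
        (\<exists>!h. h \<in> extensional (topspace Z) \<and> spectral_map Z Y h \<and> (\<forall>x \<in> X. f' x = h (f x))))"

end

theory Submission
  imports Defs
begin

text \<open>Two quasi-compact opens with the same trace on a patch-dense subset \<open>X\<close> of a spectral space
  \<open>S\<close> are equal, since their symmetric difference is patch-open. A map from \<open>X\<close> to a spectral space
  \<open>Y\<close> that is spectral with respect to the traces therefore induces a homomorphism from the lattice
  of quasi-compact opens of \<open>Y\<close> to that of \<open>S\<close>. Pulling back along it, a point of \<open>S\<close> becomes a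
  prime filter of quasi-compact opens of \<open>Y\<close>, and by sobriety such a filter is the neighbourhood
  filter of a unique point. The spectrum of a tt-category is spectral with the complements of
  supports as quasi-compact opens: compactness comes from the existence of primes disjoint from a
  multiplicative set, and the generic point of an irreducible closed set is the union of its
  members.\<close>

section \<open>Points of spectral spaces\<close>

lemma spectral_space_basis:
  assumes "spectral_space S" "openin S T" "z \<in> T"
  obtains V where "qc_open S V" "z \<in> V" "V \<subseteq> T"
proof -
  have "(arbitrary union_of (qc_open S)) T"
    using assms(1,2) by (metis spectral_space_def)
  then show ?thesis
    using assms(3) that by (auto simp: arbitrary_union_of_alt)
qed

lemma qc_open_subset: "qc_open S V \<Longrightarrow> V \<subseteq> topspace S"
  by (simp add: qc_open_def openin_subset)

lemma qc_open_empty: "qc_open S {}"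
  by (simp add: qc_open_def)

lemma qc_open_Un: "qc_open S U \<Longrightarrow> qc_open S V \<Longrightarrow> qc_open S (U \<union> V)"
  by (simp add: qc_open_def openin_Un compactin_Un)

lemma qc_open_Int: "spectral_space S \<Longrightarrow> qc_open S U \<Longrightarrow> qc_open S V \<Longrightarrow> qc_open S (U \<inter> V)"
  by (simp add: spectral_space_def)

lemma qc_open_topspace: "spectral_space S \<Longrightarrow> qc_open S (topspace S)"
  using openin_topspace[of S] unfolding spectral_space_def qc_open_def compact_space_def by blast

text \<open>If two closed sets cover the closure, one of them contains \<open>x\<close> and
  therefore the whole closure.\<close>

lemma irreducible_closed_closure_of_singleton:
  assumes "x \<in> topspace S"
  shows "irreducible_closed S (S closure_of {x})"
proof -
  have "S closure_of {x} \<subseteq> D" if "closedin S D" "x \<in> D" for D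
    using that by (simp add: closure_of_minimal)
  moreover have "x \<in> S closure_of {x}"
    using assms closure_of_subset[of "{x}" S] by auto
  ultimately show ?thesis
    unfolding irreducible_closed_def by (metis Un_iff closedin_closure_of empty_iff subset_antisym sup_ge1 sup_ge2)
qed

text \<open>Since the quasi-compact opens form a basis, the two points have the same neighbourhoods,
  hence the same closure, and the uniqueness part of sobriety identifies them.\<close>

lemma spectral_space_point_eqI:
  assumes S: "spectral_space S" and x: "x \<in> topspace S" and y: "y \<in> topspace S"
    and eq: "\<And>V. qc_open S V \<Longrightarrow> x \<in> V \<longleftrightarrow> y \<in> V"
  shows "x = y"
proof -
  have "x \<in> T \<longleftrightarrow> y \<in> T" if "openin S T" for T
    using eq spectral_space_basis[OF S that] by (metis subsetD)
  then have "S closure_of {x} = S closure_of {y}"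
    by (auto simp: in_closure_of)
  then show ?thesis
    using S x y irreducible_closed_closure_of_singleton[OF x]
    unfolding spectral_space_def sober_space_def by metis
qed

text \<open>The point is the generic point of the intersection of the complements of the quasi-compact
  opens outside the prime filter.\<close>

lemma spectral_space_prime_filter_point:
  assumes S: "spectral_space S"
    and top: "F (topspace S)" and bot: "\<not> F {}"
    and mono: "\<And>V W. qc_open S V \<Longrightarrow> qc_open S W \<Longrightarrow> V \<subseteq> W \<Longrightarrow> F V \<Longrightarrow> F W"
    and Int: "\<And>V W. qc_open S V \<Longrightarrow> qc_open S W \<Longrightarrow> F V \<Longrightarrow> F W \<Longrightarrow> F (V \<inter> W)"
    and Un: "\<And>V W. qc_open S V \<Longrightarrow> qc_open S W \<Longrightarrow> F (V \<union> W) \<Longrightarrow> F V \<or> F W"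
  obtains y where "y \<in> topspace S" "\<And>V. qc_open S V \<Longrightarrow> y \<in> V \<longleftrightarrow> F V"
proof -
  define \<G> where "\<G> = {V. qc_open S V \<and> \<not> F V}"
  define C where "C = topspace S - \<Union>\<G>"
  have fin: "qc_open S (\<Union>\<H>) \<and> \<not> F (\<Union>\<H>)" if "finite \<H>" "\<H> \<subseteq> \<G>" for \<H>
    using that
  proof (induction \<H> rule: finite_induct)
    case empty
    then show ?case by (simp add: bot qc_open_empty)
  next
    case (insert V \<H>)
    then show ?case
      using Un[of V "\<Union>\<H>"] qc_open_Un[of S V "\<Union>\<H>"] by (auto simp: \<G>_def)
  qed
  \<comment> \<open>If \<open>V\<close> missed \<open>C\<close>, then \<open>\<G>\<close> would
    cover it. Compactness reduces this to a finite subfamily, whose union is still outside the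
    filter by \<open>fin\<close>, while \<open>mono\<close> puts it inside.\<close>
  have meets: "F V \<longleftrightarrow> V \<inter> C \<noteq> {}" if V: "qc_open S V" for V
  proof
    assume "F V"
    show "V \<inter> C \<noteq> {}"
    proof
      assume "V \<inter> C = {}"
      then have "V \<subseteq> \<Union>\<G>"
        using qc_open_subset[OF V] by (auto simp: C_def)
      moreover have "\<forall>U\<in>\<G>. openin S U" "compactin S V"
        using V by (auto simp: \<G>_def qc_open_def)
      ultimately obtain \<H> where "finite \<H>" "\<H> \<subseteq> \<G>" "V \<subseteq> \<Union>\<H>"
        unfolding compactin_def by meson
      then show False
        using fin mono[OF V] \<open>F V\<close> by blast
    qed
  next
    assume "V \<inter> C \<noteq> {}"
    then show "F V"
      using V by (auto simp: C_def \<G>_def)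
  qed
  have "closedin S C"
    unfolding C_def by (intro closedin_diff closedin_topspace openin_Union) (auto simp: \<G>_def qc_open_def)
  moreover have "C \<noteq> {}"
    using meets[OF qc_open_topspace[OF S]] top by auto
  moreover have "C = D \<or> C = E" if DE: "closedin S D" "closedin S E" "C = D \<union> E" for D E
  proof (rule ccontr)
    assume "\<not> (C = D \<or> C = E)"
    then have "\<not> C \<subseteq> D" "\<not> C \<subseteq> E"
      using DE(3) by blast+
    then obtain x y where xy: "x \<in> C" "x \<notin> D" "y \<in> C" "y \<notin> E"
      by blast
    have sub: "C \<subseteq> topspace S" by (auto simp: C_def)
    \<comment> \<open>Both neighbourhoods meet \<open>C\<close>, so they belong to the filter, and
      so does \<open>V \<inter> W\<close>; thus \<open>V \<inter> W\<close> meets \<open>C\<close>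
      at a point outside \<open>D\<close> and \<open>E\<close>.\<close>
    obtain V where V: "qc_open S V" "x \<in> V" "V \<subseteq> topspace S - D"
      by (rule spectral_space_basis[OF S, of "topspace S - D" x]) (use DE xy sub in auto)
    obtain W where W: "qc_open S W" "y \<in> W" "W \<subseteq> topspace S - E"
      by (rule spectral_space_basis[OF S, of "topspace S - E" y]) (use DE xy sub in auto)
    have "F (V \<inter> W)"
      using Int meets V W xy by blast
    then have "V \<inter> W \<inter> C \<noteq> {}"
      using meets qc_open_Int[OF S] V W by blast
    then show False
      using V W DE(3) by blast
  qed
  ultimately have "irreducible_closed S C"
    unfolding irreducible_closed_def by blast
  then obtain y where y: "y \<in> topspace S" "C = S closure_of {y}"
    using S unfolding spectral_space_def sober_space_def by blast
  have "y \<in> V \<longleftrightarrow> F V" if V: "qc_open S V" for V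
  proof -
    have "V \<inter> C \<noteq> {} \<longleftrightarrow> y \<in> V"
      using y V closure_of_subset[of "{y}" S] openin_Int_closure_of_eq_empty[of S V "{y}"]
      by (auto simp: qc_open_def)
    then show ?thesis using meets[OF V] by simp
  qed
  then show ?thesis using that y by blast
qed

section \<open>Spectral closures\<close>

text \<open>The part of \<open>U\<close> outside \<open>V\<close> is patch-open, so it would contain
  a point of \<open>X\<close> if it were non-empty. The one-sided form also yields monotonicity of
  the induced lattice map.\<close>

lemma patch_dense_qc_open_subset:
  assumes dense: "patch_dense S X" and U: "qc_open S U" and V: "qc_open S V"
    and sub: "X \<inter> U \<subseteq> V"
  shows "U \<subseteq> V"
proof
  fix x assume x: "x \<in> U"
  show "x \<in> V"
  proof (rule ccontr)
    assume "x \<notin> V"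
    let ?T = "U \<inter> (topspace S - V)"
    have "openin (patch_topology S) ?T"
      using U V unfolding patch_topology_def
      by (intro openin_Int topology_generated_by_Basis) auto
    moreover have "x \<in> patch_topology S closure_of X" "x \<in> ?T"
      using dense x \<open>x \<notin> V\<close> qc_open_subset[OF U] by (auto simp: patch_dense_def)
    ultimately obtain y where "y \<in> X" "y \<in> ?T"
      unfolding in_closure_of by meson
    then show False using sub by blast
  qed
qed

lemma patch_dense_qc_open_eq:
  assumes "patch_dense S X" "qc_open S U" "qc_open S V" "X \<inter> U = X \<inter> V"
  shows "U = V"
  using patch_dense_qc_open_subset[OF assms(1)] assms(2-4) by blast

theorem patch_dense_spectral_closure:
  assumes S: "spectral_space S" and dense: "patch_dense S X"
  shows "spectral_closure TYPE('y) X {X \<inter> U | U. qc_open S U} S (\<lambda>x. x)"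
proof -
  let ?\<U> = "{X \<inter> U | U. qc_open S U}"
  have X: "X \<subseteq> topspace S"
    using dense by (simp add: patch_dense_def)
  have X_in: "X \<in> ?\<U>"
    using X qc_open_topspace[OF S] by blast
  have empty_in: "{} \<in> ?\<U>"
    using qc_open_empty[of S] by blast
  have Int_Un_in: "A \<inter> B \<in> ?\<U>" "A \<union> B \<in> ?\<U>" if AB: "A \<in> ?\<U>" "B \<in> ?\<U>" for A B
  proof -
    obtain U V where UV: "qc_open S U" "qc_open S V" "A = X \<inter> U" "B = X \<inter> V"
      using AB by blast
    have "A \<inter> B = X \<inter> (U \<inter> V)" "A \<union> B = X \<inter> (U \<union> V)"
      using UV by auto
    then show "A \<inter> B \<in> ?\<U>" "A \<union> B \<in> ?\<U>"
      using qc_open_Int[OF S UV(1,2)] qc_open_Un[OF UV(1,2)] by blast+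
  qed
  have lattice: "set_lattice_on X ?\<U>"
    unfolding set_lattice_on_def by (intro conjI ballI X_in empty_in Int_Un_in) auto
  have "{x \<in> X. x \<in> U} = X \<inter> U" for U by blast
  then have wrt: "spectral_wrt X ?\<U> S (\<lambda>x. x)"
    unfolding spectral_wrt_def using X by auto
  have "\<exists>!h. h \<in> extensional (topspace S) \<and> spectral_map S Y h \<and> (\<forall>x \<in> X. f x = h x)"
    if Y: "spectral_space Y" and f: "spectral_wrt X ?\<U> Y f" for Y :: "'y topology" and f
  proof -
    have fX: "f x \<in> topspace Y" if "x \<in> X" for x
      using f that by (auto simp: spectral_wrt_def)
    \<comment> \<open>Spectrality of \<open>f\<close> provides such a quasi-compact open and density
      makes it unique. It is the only possible preimage of \<open>V\<close> under an extension of
      \<open>f\<close>.\<close>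
    define G where "G V = (SOME U. qc_open S U \<and> X \<inter> U = {x \<in> X. f x \<in> V})" for V
    have GX: "qc_open S (G V) \<and> X \<inter> G V = {x \<in> X. f x \<in> V}" if "qc_open Y V" for V
    proof -
      have "\<exists>U. qc_open S U \<and> X \<inter> U = {x \<in> X. f x \<in> V}"
        using f that unfolding spectral_wrt_def by fastforce
      then show ?thesis
        unfolding G_def by (rule someI_ex)
    qed
    note G = GX[THEN conjunct1] and XG = GX[THEN conjunct2]
    note eqI = patch_dense_qc_open_eq[OF dense]
    \<comment> \<open>This and the following properties of \<open>G\<close> are checked on traces:
      taking preimages under \<open>f\<close> respects the lattice operations, and density lifts
      this from \<open>X\<close> to \<open>S\<close>.\<close>
    have G_top: "G (topspace Y) = topspace S"
      by (rule eqI[OF G[OF qc_open_topspace[OF Y]] qc_open_topspace[OF S]])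
        (use fX X XG[OF qc_open_topspace[OF Y]] in auto)
    have G_bot: "G {} = {}"
      by (rule eqI[OF G[OF qc_open_empty] qc_open_empty]) (use XG[OF qc_open_empty] in auto)
    have G_mono: "G V \<subseteq> G W" if VW: "qc_open Y V" "qc_open Y W" "V \<subseteq> W" for V W
      by (rule patch_dense_qc_open_subset[OF dense G[OF VW(1)] G[OF VW(2)]])
        (use XG[OF VW(1)] XG[OF VW(2)] VW(3) in blast)
    have G_Int: "G (V \<inter> W) = G V \<inter> G W" if VW: "qc_open Y V" "qc_open Y W" for V W
      by (rule eqI[OF G[OF qc_open_Int[OF Y VW]] qc_open_Int[OF S G[OF VW(1)] G[OF VW(2)]]])
        (use XG[OF VW(1)] XG[OF VW(2)] XG[OF qc_open_Int[OF Y VW]] in blast)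
    have G_Un: "G (V \<union> W) = G V \<union> G W" if VW: "qc_open Y V" "qc_open Y W" for V W
      by (rule eqI[OF G[OF qc_open_Un[OF VW]] qc_open_Un[OF G[OF VW(1)] G[OF VW(2)]]])
        (use XG[OF VW(1)] XG[OF VW(2)] XG[OF qc_open_Un[OF VW]] in blast)
    \<comment> \<open>The quasi-compact opens \<open>V\<close> with \<open>x \<in> G V\<close> form
      a prime filter because \<open>G\<close> is a lattice homomorphism. Its point is the image of
      \<open>x\<close>, and \<open>G V\<close> becomes the preimage of \<open>V\<close>.\<close>
    have "\<exists>y. y \<in> topspace Y \<and> (\<forall>V. qc_open Y V \<longrightarrow> (y \<in> V \<longleftrightarrow> x \<in> G V))"
      if x: "x \<in> topspace S" for x
    proof (rule spectral_space_prime_filter_point[OF Y, of "\<lambda>V. x \<in> G V"])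
      show "x \<in> G W" if "qc_open Y V" "qc_open Y W" "V \<subseteq> W" "x \<in> G V" for V W
        using G_mono that by blast
    qed (use x in \<open>auto simp: G_top G_bot G_Int G_Un\<close>)
    then obtain h0 where h0: "\<And>x. x \<in> topspace S \<Longrightarrow> h0 x \<in> topspace Y"
      "\<And>x V. x \<in> topspace S \<Longrightarrow> qc_open Y V \<Longrightarrow> h0 x \<in> V \<longleftrightarrow> x \<in> G V"
      by metis
    define h where "h = restrict h0 (topspace S)"
    have "{x \<in> topspace S. h x \<in> V} = G V" if "qc_open Y V" for V
      using h0(2)[OF _ that] qc_open_subset[OF G[OF that]] by (auto simp: h_def)
    then have "spectral_map S Y h"
      unfolding spectral_map_def using h0(1) G by (auto simp: h_def)
    moreover have "f x = h x" if x: "x \<in> X" for x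
    proof (rule spectral_space_point_eqI[OF Y])
      show "f x \<in> V \<longleftrightarrow> h x \<in> V" if "qc_open Y V" for V
        using h0(2)[OF _ that, of x] XG[OF that] x X by (auto simp: h_def)
    qed (use x X fX h0(1) in \<open>auto simp: h_def\<close>)
    moreover have "h1 = h2"
      if h1: "h1 \<in> extensional (topspace S)" "spectral_map S Y h1" "\<forall>x \<in> X. f x = h1 x"
        and h2: "h2 \<in> extensional (topspace S)" "spectral_map S Y h2" "\<forall>x \<in> X. f x = h2 x"
      for h1 h2
    proof (rule extensionalityI[OF h1(1) h2(1)])
      fix x assume x: "x \<in> topspace S"
      show "h1 x = h2 x"
      proof (rule spectral_space_point_eqI[OF Y])
        fix V assume V: "qc_open Y V"
        \<comment> \<open>Both preimages are quasi-compact open with the same trace on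
          \<open>X\<close>, since \<open>h1\<close> and \<open>h2\<close> agree there.\<close>
        have "{x \<in> topspace S. h1 x \<in> V} = {x \<in> topspace S. h2 x \<in> V}"
          by (rule eqI) (use h1 h2 V X in \<open>auto simp: spectral_map_def\<close>)
        then show "h1 x \<in> V \<longleftrightarrow> h2 x \<in> V"
          using x by blast
      qed (use x h1 h2 in \<open>auto simp: spectral_map_def\<close>)
    qed
    ultimately show ?thesis
      by (intro ex_ex1I exI[of _ h]) (auto simp: h_def)
  qed
  then show ?thesis
    unfolding spectral_closure_def using lattice S wrt by auto
qed

section \<open>Spectral maps, homeomorphisms and uniqueness of closures\<close>

lemma spectral_map_compose_restrict:
  assumes "spectral_map S T g" "spectral_map T R h"
  shows "spectral_map S R (restrict (h \<circ> g) (topspace S))"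
proof -
  have "{x \<in> topspace S. restrict (h \<circ> g) (topspace S) x \<in> U} =
      {x \<in> topspace S. g x \<in> {y \<in> topspace T. h y \<in> U}}" for U
    using assms by (auto simp: spectral_map_def)
  then show ?thesis
    using assms unfolding spectral_map_def by (auto simp: Pi_iff)
qed

lemma spectral_map_restrict_id: "spectral_map S S (restrict (\<lambda>x. x) (topspace S))"
proof -
  have "{x \<in> topspace S. restrict (\<lambda>x. x) (topspace S) x \<in> U} = U" if "qc_open S U" for U
    using qc_open_subset[OF that] by auto
  then show ?thesis
    by (auto simp: spectral_map_def)
qed

lemma spectral_map_continuous:
  assumes T: "spectral_space T" and h: "spectral_map S T h"
  shows "continuous_map S T h"
  unfolding continuous_map_def
proof (intro conjI allI impI)
  show "h \<in> topspace S \<rightarrow> topspace T"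
    using h by (simp add: spectral_map_def)
  fix U assume U: "openin T U"
  show "openin S {x \<in> topspace S. h x \<in> U}"
  proof (subst openin_subopen, intro ballI)
    fix x assume x: "x \<in> {x \<in> topspace S. h x \<in> U}"
    obtain V where V: "qc_open T V" "h x \<in> V" "V \<subseteq> U"
      using spectral_space_basis[OF T U] x by blast
    then have "openin S {x \<in> topspace S. h x \<in> V}"
      using h by (simp add: spectral_map_def qc_open_def)
    then show "\<exists>W. openin S W \<and> x \<in> W \<and> W \<subseteq> {x \<in> topspace S. h x \<in> U}"
      using x V by (intro exI[of _ "{x \<in> topspace S. h x \<in> V}"]) auto
  qed
qed

text \<open>The preimage of \<open>U\<close> is also the image of \<open>U\<close> under the inverse
  map, hence compact. This lets the uniqueness clause for spectral maps apply to competing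
  homeomorphisms.\<close>

lemma homeomorphic_map_spectral:
  assumes "homeomorphic_map S T h"
  shows "spectral_map S T h"
proof -
  obtain k where k: "homeomorphic_maps S T h k"
    using assms by (auto simp: homeomorphic_map_maps)
  have "qc_open S {x \<in> topspace S. h x \<in> U}" if U: "qc_open T U" for U
  proof -
    have "{x \<in> topspace S. h x \<in> U} = k ` U"
      using k qc_open_subset[OF U] unfolding homeomorphic_maps_def continuous_map_def
      by (auto simp: image_iff Pi_iff subset_iff) metis+
    moreover have "openin S {x \<in> topspace S. h x \<in> U}" "compactin S (k ` U)"
      using k U by (auto simp: homeomorphic_maps_def qc_open_def continuous_map_def
        intro: image_compactin)
    ultimately show ?thesis by (simp add: qc_open_def)
  qed
  then show ?thesis
    using assms homeomorphic_imp_continuous_map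
    by (fastforce simp: spectral_map_def continuous_map_def)
qed

lemma spectral_closure_extends:
  assumes "spectral_closure TYPE('y) X \<U> Z f" "spectral_space (Y :: 'y topology)" "spectral_wrt X \<U> Y f'"
  obtains h where "h \<in> extensional (topspace Z)" "spectral_map Z Y h" "\<And>x. x \<in> X \<Longrightarrow> f' x = h (f x)"
    "\<And>h'. h' \<in> extensional (topspace Z) \<Longrightarrow> spectral_map Z Y h' \<Longrightarrow> (\<And>x. x \<in> X \<Longrightarrow> f' x = h' (f x)) \<Longrightarrow> h' = h"
  using assms unfolding spectral_closure_def by metis

text \<open>Both \<open>h\<close> and the identity factor \<open>f\<close> through \<open>f\<close>,
  so the uniqueness clause makes them agree. They are restricted to the carrier because that clause
  speaks of extensional functions.\<close>

lemma spectral_closure_endomorphism: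
  assumes cl: "spectral_closure TYPE('z) X \<U> (Z :: 'z topology) f" and h: "spectral_map Z Z h"
    and fix_f: "\<And>x. x \<in> X \<Longrightarrow> h (f x) = f x" and z: "z \<in> topspace Z"
  shows "h z = z"
proof -
  have Z: "spectral_space Z" "spectral_wrt X \<U> Z f"
    using cl by (auto simp: spectral_closure_def)
  then have f: "f x \<in> topspace Z" if "x \<in> X" for x
    using that by (auto simp: spectral_wrt_def)
  obtain e where e: "\<And>h'. h' \<in> extensional (topspace Z) \<Longrightarrow> spectral_map Z Z h' \<Longrightarrow>
      (\<And>x. x \<in> X \<Longrightarrow> f x = h' (f x)) \<Longrightarrow> h' = e"
    by (rule spectral_closure_extends[OF cl Z]) blast
  have "restrict (h \<circ> (\<lambda>x. x)) (topspace Z) = e"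
  proof (rule e)
    have "restrict (h \<circ> restrict (\<lambda>x. x) (topspace Z)) (topspace Z) = restrict (h \<circ> (\<lambda>x. x)) (topspace Z)"
      by (auto simp: restrict_def)
    then show "spectral_map Z Z (restrict (h \<circ> (\<lambda>x. x)) (topspace Z))"
      using spectral_map_compose_restrict[OF spectral_map_restrict_id h] by simp
  qed (use fix_f f in auto)
  moreover have "restrict (\<lambda>x. x) (topspace Z) = e"
    by (rule e) (use f in \<open>auto intro: spectral_map_restrict_id\<close>)
  ultimately have "restrict (h \<circ> (\<lambda>x. x)) (topspace Z) z = restrict (\<lambda>x. x) (topspace Z) z"
    by simp
  then show ?thesis using z by simp
qed

text \<open>Each closure is tested against its own point type as well, because the two composites are
  compared with the identity as endomorphisms of \<open>Z1\<close> and \<open>Z2\<close>.\<close>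

theorem spectral_closure_unique:
  assumes Z1: "spectral_closure TYPE('b) X \<U> (Z1 :: 'a topology) f1" "spectral_closure TYPE('a) X \<U> Z1 f1"
    and Z2: "spectral_closure TYPE('a) X \<U> (Z2 :: 'b topology) f2" "spectral_closure TYPE('b) X \<U> Z2 f2"
  shows "\<exists>!h. h \<in> extensional (topspace Z1) \<and> homeomorphic_map Z1 Z2 h \<and> (\<forall>x \<in> X. h (f1 x) = f2 x)"
proof -
  have S: "spectral_space Z1" "spectral_wrt X \<U> Z1 f1" "spectral_space Z2" "spectral_wrt X \<U> Z2 f2"
    using Z1 Z2 by (auto simp: spectral_closure_def)
  then have f: "f1 x \<in> topspace Z1" "f2 x \<in> topspace Z2" if "x \<in> X" for x
    using that by (auto simp: spectral_wrt_def)
  obtain h where h: "h \<in> extensional (topspace Z1)" "spectral_map Z1 Z2 h" "\<And>x. x \<in> X \<Longrightarrow> f2 x = h (f1 x)"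
    and h_unique: "\<And>h'. h' \<in> extensional (topspace Z1) \<Longrightarrow> spectral_map Z1 Z2 h' \<Longrightarrow>
      (\<And>x. x \<in> X \<Longrightarrow> f2 x = h' (f1 x)) \<Longrightarrow> h' = h"
    by (rule spectral_closure_extends[OF Z1(1) S(3,4)]) blast
  obtain k where k: "spectral_map Z2 Z1 k" "\<And>x. x \<in> X \<Longrightarrow> f1 x = k (f2 x)"
    by (rule spectral_closure_extends[OF Z2(1) S(1,2)]) blast
  have "k (h z) = z" if z: "z \<in> topspace Z1" for z
    using spectral_closure_endomorphism[OF Z1(2) spectral_map_compose_restrict[OF h(2) k(1)] _ z]
      f h(3)[symmetric] k(2)[symmetric] z by simp
  moreover have "h (k z) = z" if z: "z \<in> topspace Z2" for z
    using spectral_closure_endomorphism[OF Z2(2) spectral_map_compose_restrict[OF k(1) h(2)] _ z]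
      f h(3)[symmetric] k(2)[symmetric] z by simp
  ultimately have "homeomorphic_maps Z1 Z2 h k"
    using spectral_map_continuous[OF S(3) h(2)] spectral_map_continuous[OF S(1) k(1)]
    by (simp add: homeomorphic_maps_def)
  then have "homeomorphic_map Z1 Z2 h"
    by (auto simp: homeomorphic_map_maps)
  with h show ?thesis
    by (intro ex1I[of _ h]) (auto intro!: h_unique homeomorphic_map_spectral)
qed

section \<open>Ideals and primes of tt-categories\<close>

lemma (in category) Hom_Ob: "f \<in> Hom K A B \<Longrightarrow> A \<in> Ob K \<and> B \<in> Ob K"
  using Dom_in Cod_in by (auto simp: Hom_def)

lemma iso_arrE:
  assumes "iso_arr K f A B"
  obtains g where "f \<in> Hom K A B" "g \<in> Hom K B A" "g \<cdot>\<^bsub>K\<^esub> f = Idt K A" "f \<cdot>\<^bsub>K\<^esub> g = Idt K B"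
    "iso_arr K g B A"
  using assms by (auto simp: iso_arr_def)

lemma (in category) endofunctor_iso_arr:
  assumes F: "endofunctor K F \<phi>" and f: "iso_arr K f A B"
  shows "iso_arr K (\<phi> f) (F A) (F B)"
proof -
  obtain g where g: "f \<in> Hom K A B" "g \<in> Hom K B A" "g \<cdot> f = Idt K A" "f \<cdot> g = Idt K B"
    using f by (rule iso_arrE)
  then have "A \<in> Ob K" "B \<in> Ob K"
    using Hom_Ob by blast+
  then show ?thesis
    using F g unfolding iso_arr_def endofunctor_def by metis
qed

section \<open>Zero arrows, zero objects and biproducts under additive functors\<close>

context additive_category
begin

lemma Zero_in: "A \<in> Ob K \<Longrightarrow> B \<in> Ob K \<Longrightarrow> Zero K A B \<in> Hom K A B"
  using hom_comm_group[of A B] monoid.one_closed[of "hom_group K A B"]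
  by (simp add: hom_group_def comm_group_def group_def)

lemma Add_Zero: "f \<in> Hom K A B \<Longrightarrow> f \<oplus> Zero K A B = f"
  using Hom_Ob[of f A B] hom_comm_group[of A B] monoid.r_one[of "hom_group K A B" f]
  by (simp add: hom_group_def comm_group_def group_def)

text \<open>Cancellation in the group of arrows; composites with zero arrows and images of zero
  arrows are recognised as zero this way.\<close>

lemma Add_idem:
  assumes "f \<in> Hom K A B" "f \<oplus> f = f"
  shows "f = Zero K A B"
proof -
  interpret G: comm_group "hom_group K A B"
    using Hom_Ob[OF assms(1)] hom_comm_group by blast
  show ?thesis
    using G.l_cancel_one'[of f f] assms by (simp add: hom_group_def)
qed

lemma Comp_Zero:
  assumes g: "g \<in> Hom K B C" and A: "A \<in> Ob K"
  shows "g \<cdot> Zero K A B = Zero K A C"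
proof -
  have z: "Zero K A B \<in> Hom K A B"
    using Zero_in A Hom_Ob[OF g] by blast
  show ?thesis
    using Comp_Add[OF z z g] Add_Zero[OF z] Comp_in[OF z g] by (intro Add_idem) auto
qed

lemma Zero_Comp:
  assumes f: "f \<in> Hom K A B" and C: "C \<in> Ob K"
  shows "Zero K B C \<cdot> f = Zero K A C"
proof -
  have z: "Zero K B C \<in> Hom K B C"
    using Zero_in C Hom_Ob[OF f] by blast
  show ?thesis
    using Add_Comp[OF f z z] Add_Zero[OF z] Comp_in[OF f z] by (intro Add_idem) auto
qed

text \<open>When the identity is zero, every arrow into or out of \<open>Z\<close> is a composite
  with a zero arrow. The equation, unlike the universal property, is visibly preserved by additive
  functors.\<close>

lemma zero_object_iff_Idt:
  assumes "Z \<in> Ob K"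
  shows "zero_object K Z \<longleftrightarrow> Idt K Z = Zero K Z Z"
proof
  assume "zero_object K Z"
  then show "Idt K Z = Zero K Z Z"
    using Idt_in[OF assms] Zero_in[OF assms assms] assms unfolding zero_object_def by blast
next
  assume Z: "Idt K Z = Zero K Z Z"
  have "f = Zero K Z A" if f: "f \<in> Hom K Z A" for f A
    using Comp_Idt[OF f] Comp_Zero[OF f assms] Z by simp
  moreover have "f = Zero K A Z" if f: "f \<in> Hom K A Z" for f A
    using Idt_Comp[OF f] Zero_Comp[OF f assms] Z by simp
  ultimately show "zero_object K Z"
    using assms Zero_in unfolding zero_object_def by metis
qed

text \<open>The isomorphism and its inverse serve as inclusion and projection for \<open>A\<close>,
  zero arrows for \<open>Z\<close>. Invariance under isomorphism thus reduces to closure under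
  direct summands.\<close>

lemma iso_arr_biproduct_zero:
  assumes f: "iso_arr K f A B" and Z: "zero_object K Z"
  shows "biproduct K A Z B"
proof -
  obtain g where g: "f \<in> Hom K A B" "g \<in> Hom K B A" "g \<cdot> f = Idt K A" "f \<cdot> g = Idt K B"
    using f by (rule iso_arrE)
  have ob: "A \<in> Ob K" "B \<in> Ob K" "Z \<in> Ob K"
    using Hom_Ob[OF g(1)] Z by (auto simp: zero_object_def)
  note z = Zero_in[OF ob(3) ob(2)] Zero_in[OF ob(2) ob(3)]
  have "Zero K B Z \<cdot> Zero K Z B = Idt K Z"
    using zero_object_iff_Idt[OF ob(3)] Z Zero_Comp[OF z(1) ob(3)] by simp
  moreover have "g \<cdot> Zero K Z B = Zero K Z A"
    using Comp_Zero g ob by blast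
  moreover have "Zero K B Z \<cdot> f = Zero K A Z"
    using Zero_Comp g ob by blast
  moreover have "(f \<cdot> g) \<oplus> (Zero K Z B \<cdot> Zero K B Z) = Idt K B"
    using Comp_Zero[OF z(1) ob(2)] Add_Zero Idt_in ob g by simp
  ultimately show ?thesis
    unfolding biproduct_def using g ob z by blast
qed

lemma additive_endofunctor_Zero:
  assumes F: "additive_endofunctor K F \<phi>" and AB: "A \<in> Ob K" "B \<in> Ob K"
  shows "\<phi> (Zero K A B) = Zero K (F A) (F B)"
proof (rule Add_idem)
  show "\<phi> (Zero K A B) \<in> Hom K (F A) (F B)"
    using F AB Zero_in unfolding additive_endofunctor_def endofunctor_def by blast
  show "\<phi> (Zero K A B) \<oplus> \<phi> (Zero K A B) = \<phi> (Zero K A B)"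
    using F AB Zero_in Add_Zero unfolding additive_endofunctor_def by metis
qed

lemma additive_endofunctor_zero_object:
  assumes F: "additive_endofunctor K F \<phi>" and Z: "zero_object K Z"
  shows "zero_object K (F Z)"
proof -
  have ob: "Z \<in> Ob K" "F Z \<in> Ob K" "\<phi> (Idt K Z) = Idt K (F Z)"
    using F Z by (auto simp: zero_object_def additive_endofunctor_def endofunctor_def)
  then show ?thesis
    using zero_object_iff_Idt Z additive_endofunctor_Zero[OF F] by metis
qed

text \<open>A biproduct is described by equations in composition, addition, identities and zeros,
  all of which an additive functor respects.\<close>

lemma additive_endofunctor_biproduct:
  assumes F: "additive_endofunctor K F \<phi>" and S: "biproduct K A B S"
  shows "biproduct K (F A) (F B) (F S)"
proof -
  obtain i j p q where ob: "A \<in> Ob K" "B \<in> Ob K" "S \<in> Ob K"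
    and hom: "i \<in> Hom K A S" "j \<in> Hom K B S" "p \<in> Hom K S A" "q \<in> Hom K S B"
    and eq: "p \<cdot> i = Idt K A" "q \<cdot> j = Idt K B" "p \<cdot> j = Zero K B A" "q \<cdot> i = Zero K A B"
      "(i \<cdot> p) \<oplus> (j \<cdot> q) = Idt K S"
    using S unfolding biproduct_def by blast
  have Fob: "F A \<in> Ob K" "F B \<in> Ob K" "F S \<in> Ob K"
    and Fhom: "\<phi> i \<in> Hom K (F A) (F S)" "\<phi> j \<in> Hom K (F B) (F S)"
      "\<phi> p \<in> Hom K (F S) (F A)" "\<phi> q \<in> Hom K (F S) (F B)"
    and FId: "\<And>C. C \<in> Ob K \<Longrightarrow> \<phi> (Idt K C) = Idt K (F C)"
    using F ob hom unfolding additive_endofunctor_def endofunctor_def by blast+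
  have FC: "\<phi> (g \<cdot> f) = \<phi> g \<cdot> \<phi> f" if "f \<in> Hom K C D" "g \<in> Hom K D E" for f g C D E
    using F that Hom_Ob unfolding additive_endofunctor_def endofunctor_def by metis
  have "\<phi> ((i \<cdot> p) \<oplus> (j \<cdot> q)) = \<phi> (i \<cdot> p) \<oplus> \<phi> (j \<cdot> q)"
    using F ob Comp_in[OF hom(3,1)] Comp_in[OF hom(4,2)] unfolding additive_endofunctor_def by blast
  then have "\<phi> p \<cdot> \<phi> i = Idt K (F A) \<and> \<phi> q \<cdot> \<phi> j = Idt K (F B) \<and>
      \<phi> p \<cdot> \<phi> j = Zero K (F B) (F A) \<and> \<phi> q \<cdot> \<phi> i = Zero K (F A) (F B) \<and>
      (\<phi> i \<cdot> \<phi> p) \<oplus> (\<phi> j \<cdot> \<phi> q) = Idt K (F S)"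
    using FC[OF hom(1,3)] FC[OF hom(2,4)] FC[OF hom(2,3)] FC[OF hom(1,4)] FC[OF hom(3,1)]
      FC[OF hom(4,2)] eq FId ob additive_endofunctor_Zero[OF F] by metis
  then show ?thesis
    unfolding biproduct_def using Fob Fhom by blast
qed

end

section \<open>Thick subcategories and their preimages under exact functors\<close>

context triangulated_category
begin

text \<open>Isomorphic objects are direct summands of each other, with zero complement.\<close>

lemma thick_subcategory_iso:
  assumes J: "thick_subcategory K J" and f: "iso_arr K f A B"
  shows "A \<in> J \<longleftrightarrow> B \<in> J"
proof -
  obtain Z where Z: "zero_object K Z"
    using zero_object_exists by blast
  obtain g where "iso_arr K g B A"
    using f by (rule iso_arrE)
  then have "biproduct K A Z B" "biproduct K B Z A"
    using iso_arr_biproduct_zero Z f by blast+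
  then show ?thesis
    using J unfolding thick_subcategory_def by blast
qed

text \<open>The comparison \<open>\<theta>\<close> corrects the target of the third arrow. Only the
  objects are kept in the conclusion, since subcategories are sets of objects.\<close>

lemma exact_endofunctor_distinguished:
  assumes F: "exact_endofunctor K F \<phi>" and tri: "distinguished_on K A B C f g h"
  obtains f' g' h' where "distinguished_on K (F A) (F B) (F C) f' g' h'"
proof -
  obtain \<theta> where iso: "\<forall>A \<in> Ob K. iso_arr K (\<theta> A) (F (Sus K A)) (Sus K (F A))"
    and "\<forall>A B C f g h. distinguished_on K A B C f g h \<longrightarrow> (\<phi> f, \<phi> g, \<theta> A \<cdot> \<phi> h) \<in> Tri K"
    using F unfolding exact_endofunctor_def by blast
  then have Tri: "(\<phi> f, \<phi> g, \<theta> A \<cdot> \<phi> h) \<in> Tri K"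
    using tri by blast
  have E: "endofunctor K F \<phi>"
    using F by (simp add: exact_endofunctor_def additive_endofunctor_def)
  have t: "A \<in> Ob K" "B \<in> Ob K" "C \<in> Ob K" "f \<in> Hom K A B" "g \<in> Hom K B C" "h \<in> Hom K C (Sus K A)"
    using tri by (auto simp: distinguished_on_def triangle_on_def)
  have FH: "\<phi> u \<in> Hom K (F D) (F E)" if "u \<in> Hom K D E" for u D E
    using E that Hom_Ob[OF that] unfolding endofunctor_def by blast
  have "\<theta> A \<cdot> \<phi> h \<in> Hom K (F C) (Sus K (F A))"
    using bspec[OF iso t(1)] Comp_in FH[OF t(6)] unfolding iso_arr_def by blast
  then have "distinguished_on K (F A) (F B) (F C) (\<phi> f) (\<phi> g) (\<theta> A \<cdot> \<phi> h)"
    unfolding distinguished_on_def triangle_on_def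
    using Tri FH[OF t(4)] FH[OF t(5)] Hom_Ob by blast
  then show ?thesis using that by blast
qed

text \<open>Exactness transports each closure condition along \<open>F\<close>. The case of
  tensoring with a fixed object gives the thickness of quotient ideals.\<close>

lemma thick_subcategory_vimage:
  assumes J: "thick_subcategory K J" and F: "exact_endofunctor K F \<phi>"
  shows "thick_subcategory K {A \<in> Ob K. F A \<in> J}"
proof -
  have add: "additive_endofunctor K F \<phi>"
    using F by (simp add: exact_endofunctor_def)
  have T: "triangulated_subcategory K J"
    and summand: "\<And>A B S. biproduct K A B S \<Longrightarrow> S \<in> J \<Longrightarrow> A \<in> J \<and> B \<in> J"
    using J unfolding thick_subcategory_def by blast+
  have zero: "\<And>Z. zero_object K Z \<Longrightarrow> Z \<in> J"
    and sum: "\<And>A B S. biproduct K A B S \<Longrightarrow> A \<in> J \<Longrightarrow> B \<in> J \<Longrightarrow> S \<in> J"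
    and sus: "\<And>A. A \<in> Ob K \<Longrightarrow> A \<in> J \<longleftrightarrow> Sus K A \<in> J"
    and tri: "\<And>A B C f g h. distinguished_on K A B C f g h \<Longrightarrow>
        (A \<in> J \<longrightarrow> B \<in> J \<longrightarrow> C \<in> J) \<and> (B \<in> J \<longrightarrow> C \<in> J \<longrightarrow> A \<in> J) \<and> (A \<in> J \<longrightarrow> C \<in> J \<longrightarrow> B \<in> J)"
    using T unfolding triangulated_subcategory_def by blast+
  \<comment> \<open>\<open>F\<close> commutes with the suspension only up to isomorphism, so
    invariance of \<open>J\<close> under isomorphism is needed here.\<close>
  have FSus: "F (Sus K A) \<in> J \<longleftrightarrow> F A \<in> J" if A: "A \<in> Ob K" for A
  proof -
    obtain u where "iso_arr K u (F (Sus K A)) (Sus K (F A))"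
      using F A unfolding exact_endofunctor_def by blast
    moreover have "F A \<in> Ob K"
      using add A by (auto simp: additive_endofunctor_def endofunctor_def)
    ultimately show ?thesis
      using thick_subcategory_iso[OF J] sus by blast
  qed
  have Sus_in: "Sus K A \<in> Ob K" if "A \<in> Ob K" for A
    using Sus_additive that by (auto simp: additive_endofunctor_def endofunctor_def)
  have Ftri: "(F A \<in> J \<longrightarrow> F B \<in> J \<longrightarrow> F C \<in> J) \<and> (F B \<in> J \<longrightarrow> F C \<in> J \<longrightarrow> F A \<in> J) \<and>
      (F A \<in> J \<longrightarrow> F C \<in> J \<longrightarrow> F B \<in> J)" if t: "distinguished_on K A B C f g h" for A B C f g h
    by (rule exact_endofunctor_distinguished[OF F t]) (rule tri)
  have tri_Ob: "A \<in> Ob K \<and> B \<in> Ob K \<and> C \<in> Ob K" if "distinguished_on K A B C f g h" for A B C f g h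
    using that by (simp add: distinguished_on_def triangle_on_def)
  have bi_Ob: "A \<in> Ob K \<and> B \<in> Ob K \<and> S \<in> Ob K" if "biproduct K A B S" for A B S
    using that by (simp add: biproduct_def)
  note Fbi = additive_endofunctor_biproduct[OF add]
  have "triangulated_subcategory K {A \<in> Ob K. F A \<in> J}"
    unfolding triangulated_subcategory_def
  proof (intro conjI)
    show "\<forall>Z. zero_object K Z \<longrightarrow> Z \<in> {A \<in> Ob K. F A \<in> J}"
      using additive_endofunctor_zero_object[OF add] zero by (auto simp: zero_object_def)
    show "\<forall>A B S. biproduct K A B S \<longrightarrow> A \<in> {A \<in> Ob K. F A \<in> J} \<longrightarrow> B \<in> {A \<in> Ob K. F A \<in> J} \<longrightarrow>
        S \<in> {A \<in> Ob K. F A \<in> J}"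
      using bi_Ob sum[OF Fbi] by blast
    show "\<forall>A\<in>Ob K. (A \<in> {A \<in> Ob K. F A \<in> J}) = (Sus K A \<in> {A \<in> Ob K. F A \<in> J})"
      using FSus Sus_in by blast
    show "\<forall>A B C f g h. distinguished_on K A B C f g h \<longrightarrow>
        (A \<in> {A \<in> Ob K. F A \<in> J} \<longrightarrow> B \<in> {A \<in> Ob K. F A \<in> J} \<longrightarrow> C \<in> {A \<in> Ob K. F A \<in> J}) \<and>
        (B \<in> {A \<in> Ob K. F A \<in> J} \<longrightarrow> C \<in> {A \<in> Ob K. F A \<in> J} \<longrightarrow> A \<in> {A \<in> Ob K. F A \<in> J}) \<and>
        (A \<in> {A \<in> Ob K. F A \<in> J} \<longrightarrow> C \<in> {A \<in> Ob K. F A \<in> J} \<longrightarrow> B \<in> {A \<in> Ob K. F A \<in> J})"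
      using tri_Ob Ftri by blast
  qed auto
  then show ?thesis
    unfolding thick_subcategory_def using bi_Ob summand[OF Fbi] by blast
qed

end

section \<open>Constructions of tt-ideals and existence of primes\<close>

context tt_category
begin

lemma tt_ideal_iso: "tt_ideal K J \<Longrightarrow> iso_arr K f A B \<Longrightarrow> A \<in> J \<longleftrightarrow> B \<in> J"
  using thick_subcategory_iso by (auto simp: tt_ideal_def)

lemma tt_ideal_subset: "tt_ideal K J \<Longrightarrow> J \<subseteq> Ob K"
  by (simp add: tt_ideal_def thick_subcategory_def triangulated_subcategory_def)

lemma tt_ideal_zero: "tt_ideal K J \<Longrightarrow> zero_object K Z \<Longrightarrow> Z \<in> J"
  by (simp add: tt_ideal_def thick_subcategory_def triangulated_subcategory_def)

lemma tt_ideal_biproduct: "tt_ideal K J \<Longrightarrow> biproduct K A B S \<Longrightarrow> S \<in> J \<longleftrightarrow> A \<in> J \<and> B \<in> J"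
  unfolding tt_ideal_def thick_subcategory_def triangulated_subcategory_def by meson

lemma tt_ideal_Tens: "tt_ideal K J \<Longrightarrow> k \<in> J \<Longrightarrow> l \<in> Ob K \<Longrightarrow> k \<odot> l \<in> J \<and> l \<odot> k \<in> J"
  by (simp add: tt_ideal_def)

lemma tt_ideal_Unit:
  assumes J: "tt_ideal K J" and "Unit K \<in> J"
  shows "J = Ob K"
proof -
  have "A \<in> J" if A: "A \<in> Ob K" for A
  proof -
    have "Unit K \<odot> A \<in> J"
      using assms A by (simp add: tt_ideal_def)
    then show ?thesis
      using tt_ideal_iso[OF J LUnit_iso[OF A]] by simp
  qed
  then show ?thesis
    using tt_ideal_subset[OF J] by blast
qed

lemma tt_ideal_Tens_commute:
  "tt_ideal K J \<Longrightarrow> A \<in> Ob K \<Longrightarrow> B \<in> Ob K \<Longrightarrow> A \<odot> B \<in> J \<longleftrightarrow> B \<odot> A \<in> J"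
  using tt_ideal_iso Braid_iso by blast

text \<open>This is the colon ideal of \<open>J\<close> by \<open>b\<close>. It is thick as a
  preimage under the exact functor tensoring with \<open>b\<close>; the associator gives closure
  under tensoring on the left, and the braiding then gives the right.\<close>

lemma tt_ideal_quotient:
  assumes J: "tt_ideal K J" and b: "b \<in> Ob K"
  shows "tt_ideal K {A \<in> Ob K. A \<odot> b \<in> J}"
proof -
  have E: "endofunctor K (\<lambda>A. A \<odot> b) (\<lambda>f. f \<boxdot> Idt K b)"
    using tensor_exact_left[OF b] by (simp add: exact_endofunctor_def additive_endofunctor_def)
  have left: "(l \<odot> k) \<odot> b \<in> J" if kl: "k \<in> Ob K" "l \<in> Ob K" "k \<odot> b \<in> J" for k l
  proof -
    have "l \<odot> (k \<odot> b) \<in> J"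
      using J kl by (simp add: tt_ideal_def)
    then show ?thesis
      using tt_ideal_iso[OF J Assoc_iso[OF kl(2,1) b]] by simp
  qed
  have right: "(k \<odot> l) \<odot> b \<in> J" if kl: "k \<in> Ob K" "l \<in> Ob K" "k \<odot> b \<in> J" for k l
    using left[OF kl] tt_ideal_iso[OF J endofunctor_iso_arr[OF E Braid_iso[OF kl(2,1)]]] by simp
  have "thick_subcategory K {A \<in> Ob K. A \<odot> b \<in> J}"
    using thick_subcategory_vimage tensor_exact_left[OF b] J unfolding tt_ideal_def by blast
  then show ?thesis
    unfolding tt_ideal_def using left right Tens_in by blast
qed

text \<open>It guarantees that some ideal contains a given object, so the ideal generated by it is a
  non-empty intersection.\<close>

lemma tt_ideal_whole: "tt_ideal K (Ob K)"
proof -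
  have "Sus K A \<in> Ob K" if "A \<in> Ob K" for A
    using Sus_additive that by (auto simp: additive_endofunctor_def endofunctor_def)
  then show ?thesis
    unfolding tt_ideal_def thick_subcategory_def triangulated_subcategory_def
    by (auto simp: zero_object_def biproduct_def distinguished_on_def triangle_on_def Tens_in)
qed

lemma tt_ideal_Inter:
  assumes ne: "\<J> \<noteq> {}" and J: "\<And>J. J \<in> \<J> \<Longrightarrow> tt_ideal K J"
  shows "tt_ideal K (\<Inter>\<J>)"
  unfolding tt_ideal_def thick_subcategory_def triangulated_subcategory_def
proof (intro conjI)
  show "\<Inter>\<J> \<subseteq> Ob K"
    using ne tt_ideal_subset J by blast
  show "\<forall>A\<in>Ob K. (A \<in> \<Inter>\<J>) = (Sus K A \<in> \<Inter>\<J>)"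
    using J unfolding tt_ideal_def thick_subcategory_def triangulated_subcategory_def by blast
  show "\<forall>A B C f g h. distinguished_on K A B C f g h \<longrightarrow>
      (A \<in> \<Inter>\<J> \<longrightarrow> B \<in> \<Inter>\<J> \<longrightarrow> C \<in> \<Inter>\<J>) \<and> (B \<in> \<Inter>\<J> \<longrightarrow> C \<in> \<Inter>\<J> \<longrightarrow> A \<in> \<Inter>\<J>) \<and>
      (A \<in> \<Inter>\<J> \<longrightarrow> C \<in> \<Inter>\<J> \<longrightarrow> B \<in> \<Inter>\<J>)"
    using J unfolding tt_ideal_def thick_subcategory_def triangulated_subcategory_def Inter_iff by meson
  show "\<forall>Z. zero_object K Z \<longrightarrow> Z \<in> \<Inter>\<J>"
    using J tt_ideal_zero by blast
  show "\<forall>A B S. biproduct K A B S \<longrightarrow> A \<in> \<Inter>\<J> \<longrightarrow> B \<in> \<Inter>\<J> \<longrightarrow> S \<in> \<Inter>\<J>"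
    using tt_ideal_biproduct[OF J] by blast
  show "\<forall>A B S. biproduct K A B S \<longrightarrow> S \<in> \<Inter>\<J> \<longrightarrow> A \<in> \<Inter>\<J> \<and> B \<in> \<Inter>\<J>"
    using tt_ideal_biproduct[OF J] by blast
  show "\<forall>k\<in>\<Inter>\<J>. \<forall>l\<in>Ob K. k \<odot> l \<in> \<Inter>\<J> \<and> l \<odot> k \<in> \<Inter>\<J>"
    using tt_ideal_Tens[OF J] by blast
qed

text \<open>Each closure condition has at most two objects as premises, and these already lie in a
  common member. It serves for chains in Zorn's lemma and for the members of an irreducible closed
  set.\<close>

lemma tt_ideal_directed_Union:
  assumes ne: "\<J> \<noteq> {}" and J: "\<And>J. J \<in> \<J> \<Longrightarrow> tt_ideal K J"
    and dir: "\<And>A B. A \<in> \<Union>\<J> \<Longrightarrow> B \<in> \<Union>\<J> \<Longrightarrow> \<exists>J \<in> \<J>. A \<in> J \<and> B \<in> J"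
  shows "tt_ideal K (\<Union>\<J>)"
  unfolding tt_ideal_def thick_subcategory_def triangulated_subcategory_def
proof (intro conjI)
  show "\<Union>\<J> \<subseteq> Ob K"
    using tt_ideal_subset J by blast
  show "\<forall>Z. zero_object K Z \<longrightarrow> Z \<in> \<Union>\<J>"
    using ne J tt_ideal_zero by blast
  show "\<forall>A B S. biproduct K A B S \<longrightarrow> A \<in> \<Union>\<J> \<longrightarrow> B \<in> \<Union>\<J> \<longrightarrow> S \<in> \<Union>\<J>"
  proof (intro allI impI)
    fix A B S assume bi: "biproduct K A B S" and AB: "A \<in> \<Union>\<J>" "B \<in> \<Union>\<J>"
    obtain I where "I \<in> \<J>" "A \<in> I" "B \<in> I"
      using dir[OF AB] by blast
    then show "S \<in> \<Union>\<J>"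
      using tt_ideal_biproduct[OF J bi] by blast
  qed
  show "\<forall>A\<in>Ob K. (A \<in> \<Union>\<J>) = (Sus K A \<in> \<Union>\<J>)"
    using J unfolding tt_ideal_def thick_subcategory_def triangulated_subcategory_def by blast
  show "\<forall>A B S. biproduct K A B S \<longrightarrow> S \<in> \<Union>\<J> \<longrightarrow> A \<in> \<Union>\<J> \<and> B \<in> \<Union>\<J>"
    using J tt_ideal_biproduct by blast
  have tri: "(A \<in> J \<longrightarrow> B \<in> J \<longrightarrow> C \<in> J) \<and> (B \<in> J \<longrightarrow> C \<in> J \<longrightarrow> A \<in> J) \<and> (A \<in> J \<longrightarrow> C \<in> J \<longrightarrow> B \<in> J)"
    if "distinguished_on K A B C f g h" "J \<in> \<J>" for A B C f g h J
    using J[OF that(2)] that(1)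
    unfolding tt_ideal_def thick_subcategory_def triangulated_subcategory_def by meson
  show "\<forall>A B C f g h. distinguished_on K A B C f g h \<longrightarrow>
      (A \<in> \<Union>\<J> \<longrightarrow> B \<in> \<Union>\<J> \<longrightarrow> C \<in> \<Union>\<J>) \<and> (B \<in> \<Union>\<J> \<longrightarrow> C \<in> \<Union>\<J> \<longrightarrow> A \<in> \<Union>\<J>) \<and>
      (A \<in> \<Union>\<J> \<longrightarrow> C \<in> \<Union>\<J> \<longrightarrow> B \<in> \<Union>\<J>)"
  proof (intro allI impI conjI)
    fix A B C f g h assume t: "distinguished_on K A B C f g h"
    show "C \<in> \<Union>\<J>" if AB: "A \<in> \<Union>\<J>" "B \<in> \<Union>\<J>"
      using dir[OF AB] tri[OF t] by blast
    show "A \<in> \<Union>\<J>" if BC: "B \<in> \<Union>\<J>" "C \<in> \<Union>\<J>"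
      using dir[OF BC] tri[OF t] by blast
    show "B \<in> \<Union>\<J>" if AC: "A \<in> \<Union>\<J>" "C \<in> \<Union>\<J>"
      using dir[OF AC] tri[OF t] by blast
  qed
  show "\<forall>k\<in>\<Union>\<J>. \<forall>l\<in>Ob K. k \<odot> l \<in> \<Union>\<J> \<and> l \<odot> k \<in> \<Union>\<J>"
    using J unfolding tt_ideal_def by blast
qed

text \<open>Balmer's prime existence lemma: for an ideal \<open>M\<close> maximal among those disjoint from a
  multiplicative set and for \<open>b \<notin> M\<close>, the ideal of all \<open>A\<close> with \<open>A \<otimes> b \<in> M\<close> cannot be larger
  than \<open>M\<close>.\<close>

lemma prime_tt_ideal_exists:
  assumes J: "tt_ideal K J" and S: "S \<subseteq> Ob K" "Unit K \<in> S"
    and mult: "\<And>s t. s \<in> S \<Longrightarrow> t \<in> S \<Longrightarrow> s \<odot> t \<in> S" and disj: "J \<inter> S = {}"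
  obtains P where "prime_tt_ideal K P" "J \<subseteq> P" "P \<inter> S = {}"
proof -
  define \<A> where "\<A> = {I. tt_ideal K I \<and> J \<subseteq> I \<and> I \<inter> S = {}}"
  have "\<exists>M\<in>\<A>. \<forall>I\<in>\<A>. M \<subseteq> I \<longrightarrow> I = M"
  proof (rule subset_Zorn_nonempty)
    show "\<A> \<noteq> {}"
      using J disj by (auto simp: \<A>_def)
    fix \<C> assume \<C>: "\<C> \<noteq> {}" "subset.chain \<A> \<C>"
    have "\<exists>I\<in>\<C>. A \<in> I \<and> B \<in> I" if "A \<in> \<Union>\<C>" "B \<in> \<Union>\<C>" for A B
      using that \<C>(2) unfolding subset_chain_def by (metis UnionE subsetD)
    then have "tt_ideal K (\<Union>\<C>)"
      using \<C> by (intro tt_ideal_directed_Union) (auto simp: \<A>_def subset_chain_def)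
    then show "\<Union>\<C> \<in> \<A>"
      using \<C> unfolding \<A>_def subset_chain_def by blast
  qed
  then obtain M where "M \<in> \<A>" and maximal: "\<forall>I\<in>\<A>. M \<subseteq> I \<longrightarrow> I = M"
    by blast
  then have M: "tt_ideal K M" "J \<subseteq> M" "M \<inter> S = {}"
    by (auto simp: \<A>_def)
  have max: "I = M" if "tt_ideal K I" "M \<subseteq> I" "I \<inter> S = {}" for I
    using maximal that M(2) by (auto simp: \<A>_def)
  \<comment> \<open>The quotient ideal of \<open>M\<close> by \<open>b\<close> contains
    \<open>M\<close> and also \<open>a\<close>, so by maximality it cannot be disjoint from
    \<open>S\<close>.\<close>
  have meets: "\<exists>s\<in>S. s \<odot> b \<in> M" if ab: "a \<in> Ob K" "b \<in> Ob K" "a \<odot> b \<in> M" "a \<notin> M" for a b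
  proof (rule ccontr)
    assume "\<not> (\<exists>s\<in>S. s \<odot> b \<in> M)"
    moreover have "M \<subseteq> {A \<in> Ob K. A \<odot> b \<in> M}"
      using M(1) tt_ideal_subset[OF M(1)] ab(2) by (auto simp: tt_ideal_def)
    ultimately have "{A \<in> Ob K. A \<odot> b \<in> M} = M"
      using tt_ideal_quotient[OF M(1) ab(2)] by (intro max) auto
    then show False
      using ab by blast
  qed
  have "a \<in> M \<or> b \<in> M" if ab: "a \<in> Ob K" "b \<in> Ob K" "a \<odot> b \<in> M" for a b
  proof (rule ccontr)
    assume "\<not> (a \<in> M \<or> b \<in> M)"
    then have n: "a \<notin> M" "b \<notin> M" by auto
    obtain s where s: "s \<in> S" "s \<odot> b \<in> M"
      using meets[OF ab n(1)] by blast
    \<comment> \<open>Swapping the factors allows a second use of \<open>meets\<close>, now for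
      \<open>b\<close> and \<open>s\<close>. It produces a product of two elements of
      \<open>S\<close> lying in \<open>M\<close>.\<close>
    then have "s \<in> Ob K" "b \<odot> s \<in> M"
      using S tt_ideal_Tens_commute[OF M(1) ab(2)] by blast+
    then obtain t where "t \<in> S" "t \<odot> s \<in> M"
      using meets[OF ab(2) _ _ n(2)] by blast
    then show False
      using mult s M(3) by blast
  qed
  moreover have "M \<noteq> Ob K"
    using S M(3) by blast
  ultimately have "prime_tt_ideal K M"
    using M(1) by (simp add: prime_tt_ideal_def)
  then show ?thesis using that M by blast
qed

lemma prime_tt_ideal_imp_tt_ideal: "prime_tt_ideal K P \<Longrightarrow> tt_ideal K P"
  by (simp add: prime_tt_ideal_def)

lemma prime_tt_ideal_Tens:
  assumes "prime_tt_ideal K P" "k \<in> Ob K" "l \<in> Ob K"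
  shows "k \<odot> l \<in> P \<longleftrightarrow> k \<in> P \<or> l \<in> P"
  using assms tt_ideal_Tens unfolding prime_tt_ideal_def by blast

lemma prime_tt_ideal_Unit: "prime_tt_ideal K P \<Longrightarrow> Unit K \<notin> P"
  using tt_ideal_Unit by (auto simp: prime_tt_ideal_def)

section \<open>The spectrum is spectral\<close>

text \<open>On these basic opens tensor products become unions and biproducts become intersections,
  so they form a lattice of sets.\<close>

definition supp_compl :: "'o \<Rightarrow> 'o set set" where
  "supp_compl k = {P. prime_tt_ideal K P} - supp K k"

lemma mem_supp_compl: "P \<in> supp_compl k \<longleftrightarrow> prime_tt_ideal K P \<and> k \<in> P"
  by (auto simp: supp_compl_def supp_def)

lemma supp_compl_Unit: "supp_compl (Unit K) = {}"
  using prime_tt_ideal_Unit by (auto simp: mem_supp_compl)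

lemma supp_compl_Tens:
  "k \<in> Ob K \<Longrightarrow> l \<in> Ob K \<Longrightarrow> supp_compl (k \<odot> l) = supp_compl k \<union> supp_compl l"
  using prime_tt_ideal_Tens by (auto simp: mem_supp_compl)

lemma supp_compl_biproduct: "biproduct K k l s \<Longrightarrow> supp_compl s = supp_compl k \<inter> supp_compl l"
  using tt_ideal_biproduct prime_tt_ideal_imp_tt_ideal by (auto simp: mem_supp_compl)

lemma supp_compl_zero_object: "zero_object K Z \<Longrightarrow> supp_compl Z = topspace (Spc K)"
  using tt_ideal_zero prime_tt_ideal_imp_tt_ideal by (auto simp: mem_supp_compl topspace_Spc)

section \<open>Quasi-compact opens of the spectrum\<close>

lemma openin_Spc_iff:
  "openin (Spc K) U \<longleftrightarrow> U \<subseteq> topspace (Spc K) \<and> (\<forall>P\<in>U. \<exists>k\<in>Ob K. P \<in> supp_compl k \<and> supp_compl k \<subseteq> U)"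
proof -
  have "openin (Spc K) U \<longleftrightarrow> (\<forall>P\<in>U. \<exists>k\<in>Ob K. P \<in> supp_compl k \<and> supp_compl k \<subseteq> U)"
    unfolding openin_Spc arbitrary_union_of_alt supp_compl_def[symmetric]
    by (intro ball_cong refl) blast
  then show ?thesis
    using openin_subset by blast
qed

lemma openin_supp_compl: "k \<in> Ob K \<Longrightarrow> openin (Spc K) (supp_compl k)"
  unfolding openin_Spc_iff by (auto simp: mem_supp_compl topspace_Spc)

text \<open>The tensor product of the members of \<open>A\<close> works; for the empty family it is
  the unit, which lies in no prime.\<close>

lemma finite_Union_supp_compl:
  assumes "finite A" "A \<subseteq> Ob K"
  obtains k where "k \<in> Ob K" "supp_compl k = \<Union>(supp_compl ` A)"
  using assms
proof (induction A arbitrary: thesis rule: finite_induct)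
  case empty
  then show ?case using Unit_in supp_compl_Unit by auto
next
  case (insert a A)
  then obtain k where k: "k \<in> Ob K" "supp_compl k = \<Union>(supp_compl ` A)"
    by auto
  with insert show ?case
    using Tens_in[of a k] supp_compl_Tens[of a k] by auto
qed

text \<open>If no finite subfamily covers, then the objects whose \<open>supp_compl\<close> lies in a finite union of
  the family form a multiplicative set disjoint from the ideal generated by \<open>k\<close>, and a prime
  separating the two is not covered at all.\<close>

lemma supp_compl_finite_subcover:
  assumes k: "k \<in> Ob K" and A: "A \<subseteq> Ob K" and cover: "supp_compl k \<subseteq> \<Union>(supp_compl ` A)"
  obtains B where "finite B" "B \<subseteq> A" "supp_compl k \<subseteq> \<Union>(supp_compl ` B)"
proof (rule ccontr)
  assume "\<not> thesis"
  then have none: "\<not> supp_compl k \<subseteq> \<Union>(supp_compl ` B)" if "finite B" "B \<subseteq> A" for B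
    using that \<open>\<And>B. finite B \<Longrightarrow> B \<subseteq> A \<Longrightarrow> supp_compl k \<subseteq> \<Union>(supp_compl ` B) \<Longrightarrow> thesis\<close> by blast
  define S where "S = {s \<in> Ob K. \<exists>B. finite B \<and> B \<subseteq> A \<and> supp_compl s \<subseteq> \<Union>(supp_compl ` B)}"
  define J where "J = \<Inter>{J. tt_ideal K J \<and> k \<in> J}"
  have J: "tt_ideal K J"
    unfolding J_def using tt_ideal_whole k by (intro tt_ideal_Inter) auto
  have "s \<odot> t \<in> S" if st: "s \<in> S" "t \<in> S" for s t
  proof -
    obtain B C where "finite B" "B \<subseteq> A" "supp_compl s \<subseteq> \<Union>(supp_compl ` B)"
      "finite C" "C \<subseteq> A" "supp_compl t \<subseteq> \<Union>(supp_compl ` C)" "s \<in> Ob K" "t \<in> Ob K"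
      using st unfolding S_def by blast
    then show ?thesis
      unfolding S_def using Tens_in supp_compl_Tens by (auto intro!: exI[of _ "B \<union> C"])
  qed
  moreover have "S \<subseteq> Ob K" "Unit K \<in> S"
    unfolding S_def using Unit_in supp_compl_Unit by (auto intro!: exI[of _ "{}"])
  moreover have "J \<inter> S = {}"
  proof -
    have "s \<notin> S" if "s \<in> J" for s
    proof
      assume "s \<in> S"
      then obtain B where B: "finite B" "B \<subseteq> A" "supp_compl s \<subseteq> \<Union>(supp_compl ` B)"
        unfolding S_def by blast
      \<comment> \<open>A prime containing \<open>k\<close> contains the ideal \<open>J\<close>
        generated by \<open>k\<close>, and in particular \<open>s\<close>.\<close>
      have "supp_compl k \<subseteq> supp_compl s"
        using that by (auto simp: J_def mem_supp_compl prime_tt_ideal_imp_tt_ideal)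
      then show False
        using none[OF B(1,2)] B(3) by order
    qed
    then show ?thesis by blast
  qed
  ultimately obtain P where P: "prime_tt_ideal K P" "J \<subseteq> P" "P \<inter> S = {}"
    using prime_tt_ideal_exists[OF J] by blast
  have "k \<in> J" by (auto simp: J_def)
  then have "P \<in> supp_compl k"
    using P by (auto simp: mem_supp_compl)
  then obtain a where "a \<in> A" "P \<in> supp_compl a"
    using cover by blast
  \<comment> \<open>The one-element family witnesses this. As \<open>P\<close> is disjoint from
    \<open>S\<close>, it contains no member of \<open>A\<close>.\<close>
  moreover have "a \<in> S" if "a \<in> A" for a
    unfolding S_def using that A by (auto intro!: exI[of _ "{a}"])
  ultimately show False
    using P by (auto simp: mem_supp_compl)
qed

lemma compactin_supp_compl:
  assumes k: "k \<in> Ob K"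
  shows "compactin (Spc K) (supp_compl k)"
  unfolding compactin_def
proof (intro conjI allI impI)
  show "supp_compl k \<subseteq> topspace (Spc K)"
    using openin_supp_compl[OF k] by (rule openin_subset)
  fix \<W> assume \<W>: "Ball \<W> (openin (Spc K)) \<and> supp_compl k \<subseteq> \<Union>\<W>"
  \<comment> \<open>The cover is refined to the basic opens contained in one of its members, which
    reduces the claim to covers by basic opens.\<close>
  define A where "A = {a \<in> Ob K. \<exists>W\<in>\<W>. supp_compl a \<subseteq> W}"
  have "supp_compl k \<subseteq> \<Union>(supp_compl ` A)"
  proof
    fix P assume "P \<in> supp_compl k"
    then obtain W where "W \<in> \<W>" "P \<in> W" "openin (Spc K) W"
      using \<W> by blast
    then show "P \<in> \<Union>(supp_compl ` A)"
      unfolding A_def openin_Spc_iff by blast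
  qed
  moreover have "A \<subseteq> Ob K" by (auto simp: A_def)
  ultimately obtain B where B: "finite B" "B \<subseteq> A" "supp_compl k \<subseteq> \<Union>(supp_compl ` B)"
    using supp_compl_finite_subcover[OF k] by blast
  have "\<forall>b\<in>B. \<exists>W. W \<in> \<W> \<and> supp_compl b \<subseteq> W"
    using B by (auto simp: A_def)
  then obtain w where w: "\<And>b. b \<in> B \<Longrightarrow> w b \<in> \<W> \<and> supp_compl b \<subseteq> w b"
    by metis
  then show "\<exists>\<F>. finite \<F> \<and> \<F> \<subseteq> \<W> \<and> supp_compl k \<subseteq> \<Union>\<F>"
    using B by (intro exI[of _ "w ` B"]) blast
qed

text \<open>Compactness makes such an open set a finite union of basic opens, which a tensor product
  turns into a single one.\<close>

lemma qc_open_Spc_iff: "qc_open (Spc K) U \<longleftrightarrow> (\<exists>k\<in>Ob K. U = supp_compl k)"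
proof
  assume U: "qc_open (Spc K) U"
  define A where "A = {a \<in> Ob K. supp_compl a \<subseteq> U}"
  have "U = \<Union>(supp_compl ` A)"
    using U unfolding qc_open_def openin_Spc_iff A_def by blast
  moreover have "Ball (supp_compl ` A) (openin (Spc K))"
    using openin_supp_compl by (auto simp: A_def)
  ultimately obtain \<F> where "finite \<F>" "\<F> \<subseteq> supp_compl ` A" "U \<subseteq> \<Union>\<F>"
    using U unfolding qc_open_def compactin_def by (metis order_refl)
  then obtain B where B: "finite B" "B \<subseteq> A" "U \<subseteq> \<Union>(supp_compl ` B)"
    using finite_subset_image by metis
  then have "U = \<Union>(supp_compl ` B)" "B \<subseteq> Ob K"
    by (auto simp: A_def)
  then show "\<exists>k\<in>Ob K. U = supp_compl k"
    using finite_Union_supp_compl[OF B(1)] by metis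
qed (auto simp: qc_open_def openin_supp_compl compactin_supp_compl)

section \<open>Closures of points, generic points and sobriety\<close>

lemma closure_of_singleton_Spc:
  assumes P: "prime_tt_ideal K P"
  shows "Spc K closure_of {P} = {Q. prime_tt_ideal K Q \<and> Q \<subseteq> P}"
proof -
  \<comment> \<open>It suffices to test basic opens, where membership of a prime means containing
    \<open>k\<close>. Specialisation therefore goes to smaller primes, opposite to the order for
    prime ideals of rings.\<close>
  have "(\<forall>U. Q \<in> U \<and> openin (Spc K) U \<longrightarrow> P \<in> U) \<longleftrightarrow> Q \<subseteq> P" if Q: "prime_tt_ideal K Q" for Q
  proof
    assume *: "\<forall>U. Q \<in> U \<and> openin (Spc K) U \<longrightarrow> P \<in> U"
    show "Q \<subseteq> P"
    proof
      fix k assume k: "k \<in> Q"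
      then have "k \<in> Ob K"
        using Q tt_ideal_subset prime_tt_ideal_imp_tt_ideal by blast
      moreover have "Q \<in> supp_compl k"
        using Q k by (simp add: mem_supp_compl)
      ultimately have "P \<in> supp_compl k"
        using * openin_supp_compl by blast
      then show "k \<in> P" by (simp add: mem_supp_compl)
    qed
  next
    assume "Q \<subseteq> P"
    show "\<forall>U. Q \<in> U \<and> openin (Spc K) U \<longrightarrow> P \<in> U"
    proof (intro allI impI)
      fix U assume "Q \<in> U \<and> openin (Spc K) U"
      then obtain k where "Q \<in> supp_compl k" "supp_compl k \<subseteq> U"
        unfolding openin_Spc_iff by blast
      moreover from this have "P \<in> supp_compl k"
        using P \<open>Q \<subseteq> P\<close> by (auto simp: mem_supp_compl)
      ultimately show "P \<in> U" by blast
    qed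
  qed
  then show ?thesis
    unfolding closure_of_def topspace_Spc by auto
qed

text \<open>Irreducibility makes \<open>C\<close> directed, so \<open>\<Union>C\<close> is an ideal,
  and primality is inherited from the members. If \<open>\<Union>C\<close> were outside
  \<open>C\<close>, a basic open around it would miss \<open>C\<close>, although its defining object
  lies in some member.\<close>

lemma irreducible_closed_Spc_generic:
  assumes C: "irreducible_closed (Spc K) C"
  shows "prime_tt_ideal K (\<Union>C)" "\<Union>C \<in> C"
proof -
  have ne: "C \<noteq> {}" and cl: "closedin (Spc K) C"
    and irr: "\<And>D E. closedin (Spc K) D \<Longrightarrow> closedin (Spc K) E \<Longrightarrow> C = D \<union> E \<Longrightarrow> C = D \<or> C = E"
    using C unfolding irreducible_closed_def by blast+
  have prime: "prime_tt_ideal K Q" if "Q \<in> C" for Q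
    using that closedin_subset[OF cl] by (auto simp: topspace_Spc)
  have sub: "Q \<subseteq> Ob K" if "Q \<in> C" for Q
    using prime[OF that] tt_ideal_subset prime_tt_ideal_imp_tt_ideal by blast
  have directed: "\<exists>Q\<in>C. A \<in> Q \<and> B \<in> Q" if AB: "A \<in> \<Union>C" "B \<in> \<Union>C" for A B
  proof (rule ccontr)
    assume none: "\<not> (\<exists>Q\<in>C. A \<in> Q \<and> B \<in> Q)"
    have ob: "A \<in> Ob K" "B \<in> Ob K"
      using AB sub by blast+
    have "Q \<notin> supp_compl A \<or> Q \<notin> supp_compl B" if "Q \<in> C" for Q
      using none that unfolding mem_supp_compl by blast
    \<comment> \<open>If no member contains both objects, the members omitting \<open>A\<close> and
      those omitting \<open>B\<close> are two closed sets covering \<open>C\<close>, and one of them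
      must be everything.\<close>
    then have "C = (C - supp_compl A) \<union> (C - supp_compl B)"
      by blast
    then have "C = C - supp_compl A \<or> C = C - supp_compl B"
      by (rule irr[OF closedin_diff[OF cl openin_supp_compl[OF ob(1)]]
        closedin_diff[OF cl openin_supp_compl[OF ob(2)]]])
    then show False
      using AB prime by (metis DiffD2 UnionE mem_supp_compl)
  qed
  have "tt_ideal K (\<Union>C)"
    by (rule tt_ideal_directed_Union[OF ne prime_tt_ideal_imp_tt_ideal[OF prime] directed])
  moreover have "Unit K \<notin> \<Union>C"
    using prime prime_tt_ideal_Unit by blast
  moreover have "k \<in> \<Union>C \<or> l \<in> \<Union>C" if "k \<in> Ob K" "l \<in> Ob K" "k \<odot> l \<in> \<Union>C" for k l
    using that prime prime_tt_ideal_Tens by blast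
  ultimately show P: "prime_tt_ideal K (\<Union>C)"
    unfolding prime_tt_ideal_def using Unit_in by blast
  show "\<Union>C \<in> C"
  proof (rule ccontr)
    assume "\<Union>C \<notin> C"
    moreover have "openin (Spc K) (topspace (Spc K) - C)"
      using cl by blast
    ultimately obtain k where "\<Union>C \<in> supp_compl k" "supp_compl k \<subseteq> topspace (Spc K) - C"
      using P unfolding openin_Spc_iff topspace_Spc by blast
    moreover from this obtain Q where "Q \<in> C" "k \<in> Q"
      by (auto simp: mem_supp_compl)
    moreover from this have "Q \<in> supp_compl k"
      using prime by (simp add: mem_supp_compl)
    ultimately show False by blast
  qed
qed

lemma sober_space_Spc: "sober_space (Spc K)"
  unfolding sober_space_def
proof (intro allI impI)
  fix C assume C: "irreducible_closed (Spc K) C"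
  note P = irreducible_closed_Spc_generic[OF C]
  have cl: "closedin (Spc K) C"
    using C by (simp add: irreducible_closed_def)
  have "C = Spc K closure_of {\<Union>C}"
  proof
    show "C \<subseteq> Spc K closure_of {\<Union>C}"
      using closedin_subset[OF cl] by (auto simp: closure_of_singleton_Spc[OF P(1)] topspace_Spc)
    show "Spc K closure_of {\<Union>C} \<subseteq> C"
      using cl P(2) by (simp add: closure_of_minimal)
  qed
  moreover have "Q = \<Union>C" if Q: "Q \<in> topspace (Spc K)" "C = Spc K closure_of {Q}" for Q
  proof -
    \<comment> \<open>So \<open>Q\<close> is the largest member of \<open>C\<close> and equals the
      union.\<close>
    have "C = {R. prime_tt_ideal K R \<and> R \<subseteq> Q}"
      using Q closure_of_singleton_Spc by (simp add: topspace_Spc)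
    moreover have "prime_tt_ideal K Q"
      using Q by (simp add: topspace_Spc)
    ultimately show ?thesis by blast
  qed
  ultimately show "\<exists>!x. x \<in> topspace (Spc K) \<and> C = Spc K closure_of {x}"
    using P(1) by (intro ex1I[of _ "\<Union>C"]) (auto simp: topspace_Spc)
qed

text \<open>The whole space is the basic open of a zero object, hence quasi-compact; biproducts
  provide the intersections of quasi-compact opens.\<close>

theorem spectral_space_Spc: "spectral_space (Spc K)"
  unfolding spectral_space_def
proof (intro conjI allI impI sober_space_Spc)
  obtain Z where Z: "zero_object K Z"
    using zero_object_exists by blast
  then show "compact_space (Spc K)"
    using compactin_supp_compl[of Z] supp_compl_zero_object[OF Z]
    by (simp add: compact_space_def zero_object_def)
  have "qc_open (Spc K) = (\<lambda>U. \<exists>k\<in>Ob K. U = {P. prime_tt_ideal K P} - supp K k)"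
    by (intro ext) (simp add: qc_open_Spc_iff supp_compl_def)
  then show "openin (Spc K) = arbitrary union_of qc_open (Spc K)"
    by (simp add: openin_Spc)
  show "qc_open (Spc K) (U \<inter> V)" if UV: "qc_open (Spc K) U" "qc_open (Spc K) V" for U V
  proof -
    obtain k l where kl: "k \<in> Ob K" "l \<in> Ob K" "U = supp_compl k" "V = supp_compl l"
      using UV unfolding qc_open_Spc_iff by blast
    obtain s where s: "biproduct K k l s"
      using biproduct_exists kl by blast
    then show ?thesis
      using kl supp_compl_biproduct[OF s] unfolding qc_open_Spc_iff biproduct_def by blast
  qed
qed

end

text \<open>The lattice in the second conjunct is expressed through restricted supports alone. The
  last conjunct makes the reconstruction precise: any closure built from that lattice is uniquely
  homeomorphic to the spectrum over \<open>X\<close>.\<close>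

theorem corollary2p10:
  fixes K :: "('o, 'm) tt_data" and X :: "'o set set"
  assumes "tt_category K"
    and "X \<subseteq> topspace (Spc K)"
    and "patch_dense (Spc K) X"
  shows "spectral_closure TYPE('y) X {X \<inter> (topspace (Spc K) - supp K k) | k. k \<in> Ob K} (Spc K) (\<lambda>P. P)
    \<and> spectral_closure TYPE('y) X {X - restricted_supp K X k | k. k \<in> Ob K} (Spc K) (\<lambda>P. P)
    \<and> (\<forall>(Z :: 'y topology) g.
          spectral_closure TYPE('y) X {X - restricted_supp K X k | k. k \<in> Ob K} Z g \<longrightarrow>
          spectral_closure TYPE('o set) X {X - restricted_supp K X k | k. k \<in> Ob K} Z g \<longrightarrow>
          (\<exists>!h. h \<in> extensional (topspace (Spc K)) \<and> homeomorphic_map (Spc K) Z h \<and>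
               (\<forall>P \<in> X. h P = g P)))"
proof -
  interpret tt_category K by fact
  have "{X \<inter> U | U. qc_open (Spc K) U} = {X \<inter> (topspace (Spc K) - supp K k) | k. k \<in> Ob K}"
    by (auto simp: qc_open_Spc_iff supp_compl_def topspace_Spc)
  moreover have "X \<inter> (topspace (Spc K) - supp K k) = X - restricted_supp K X k" for k
    using assms(2) by (auto simp: restricted_supp_def)
  ultimately have eq: "{X \<inter> U | U. qc_open (Spc K) U} = {X - restricted_supp K X k | k. k \<in> Ob K}"
    "{X \<inter> (topspace (Spc K) - supp K k) | k. k \<in> Ob K} = {X - restricted_supp K X k | k. k \<in> Ob K}"
    by simp_all
  \<comment> \<open>The closure property is instantiated at the point type of \<open>Z\<close> and
    at that of the spectrum, as \<open>spectral_closure_unique\<close> requires both.\<close>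
  note y = patch_dense_spectral_closure[OF spectral_space_Spc assms(3), where 'y = 'y, unfolded eq]
  note o = patch_dense_spectral_closure[OF spectral_space_Spc assms(3), where 'y = "'o set", unfolded eq]
  show ?thesis
    unfolding eq using y spectral_closure_unique[OF y o] by simp
qed

end
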